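(* If there is an output-polynomial time algorithm for enumerating all globally minimal defensive alliances of split graphs, then there is an output-polynomial time algorithm for enumerating all (inclusion-wise) minimal dominating sets of general graphs.
   Context: Graphs are finite, simple and undirected. For $G=(V,E)$, $X\subseteq V$ and $v\in V$, $\deg_X(v)$ is the number of neighbors of $v$ in $X$, and $\overline{X}=V\setminus X$. A set $A\subseteq V$ is a defensive alliance if $\deg_A(v)+1\ge \deg_{\overline{A}}(v)$ for every $v\in A$. A non-empty defensive alliance is globally minimal if no proper subset of it is a non-empty defensive alliance. A split graph is a graph whose vertex set can be partitioned into an independent set and a clique. An enumeration algorithm (which outputs every solution exactly once) runs in output-polynomial time if its total running time is bounded by a polynomial in the input size and the number of solutions. *)

theory Defs
  imports Main
begin

section \<open>Graphs\<close>

definition simple_graph :: "'a set \<Rightarrow> 'a set set \<Rightarrow> bool" where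
  "simple_graph V E \<longleftrightarrow>
     finite V \<and> (\<forall>e\<in>E. \<exists>u v. u \<in> V \<and> v \<in> V \<and> u \<noteq> v \<and> e = {u, v})"

definition deg_in :: "'a set set \<Rightarrow> 'a set \<Rightarrow> 'a \<Rightarrow> nat" where
  "deg_in E X v = card {u \<in> X. {u, v} \<in> E}"

definition independent_set :: "'a set set \<Rightarrow> 'a set \<Rightarrow> bool" where
  "independent_set E I \<longleftrightarrow> (\<forall>u\<in>I. \<forall>v\<in>I. {u, v} \<notin> E)"

definition clique :: "'a set set \<Rightarrow> 'a set \<Rightarrow> bool" where
  "clique E C \<longleftrightarrow> (\<forall>u\<in>C. \<forall>v\<in>C. u \<noteq> v \<longrightarrow> {u, v} \<in> E)"

text \<open>Either part of the partition may be empty.\<close>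

definition split_graph :: "'a set \<Rightarrow> 'a set set \<Rightarrow> bool" where
  "split_graph V E \<longleftrightarrow> simple_graph V E \<and>
     (\<exists>I C. I \<union> C = V \<and> I \<inter> C = {} \<and> independent_set E I \<and> clique E C)"

definition defensive_alliance :: "'a set \<Rightarrow> 'a set set \<Rightarrow> 'a set \<Rightarrow> bool" where
  "defensive_alliance V E A \<longleftrightarrow>
     A \<subseteq> V \<and> (\<forall>v\<in>A. deg_in E A v + 1 \<ge> deg_in E (V - A) v)"

definition globally_minimal_defensive_alliance ::
    "'a set \<Rightarrow> 'a set set \<Rightarrow> 'a set \<Rightarrow> bool" where
  "globally_minimal_defensive_alliance V E A \<longleftrightarrow>
     A \<noteq> {} \<and> defensive_alliance V E A \<and>
     (\<forall>B. B \<subset> A \<longrightarrow> \<not> (B \<noteq> {} \<and> defensive_alliance V E B))"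

definition dominating_set :: "'a set \<Rightarrow> 'a set set \<Rightarrow> 'a set \<Rightarrow> bool" where
  "dominating_set V E D \<longleftrightarrow> D \<subseteq> V \<and> (\<forall>v\<in>V. v \<in> D \<or> (\<exists>u\<in>D. {u, v} \<in> E))"

definition minimal_dominating_set :: "'a set \<Rightarrow> 'a set set \<Rightarrow> 'a set \<Rightarrow> bool" where
  "minimal_dominating_set V E D \<longleftrightarrow>
     dominating_set V E D \<and> (\<forall>D'. D' \<subset> D \<longrightarrow> \<not> dominating_set V E D')"


section \<open>Model of computation\<close>

text \<open>
  Algorithms are programs of Jones' language WHILE (N. D. Jones, Computability and
  Complexity from a Programming Perspective, MIT Press 1997): imperative programs whose
  data are binary trees over the single atom \<open>Leaf\<close>. Every operator costs one time unit.
  With trees represented by shared pointers each operator is a constant number of heap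
  operations, and conversely a Turing machine tape is a pair of lists, so running times
  in this model and on Turing machines agree up to a polynomial. There is no equality test
  on trees (which could not be charged a constant); conditions only test for \<open>Leaf\<close>.
\<close>

datatype tree = Leaf | Node tree tree

datatype expr = Var nat | LeafE | NodeE expr expr | LeftE expr | RightE expr

datatype com =
    Skip
  | Assign nat expr
  | Seq com com
  | Cond expr com com
  | While expr com

type_synonym store = "nat \<Rightarrow> tree"

fun left :: "tree \<Rightarrow> tree" where
  "left Leaf = Leaf"
| "left (Node a b) = a"

fun right :: "tree \<Rightarrow> tree" where
  "right Leaf = Leaf"
| "right (Node a b) = b"

fun eval_expr :: "expr \<Rightarrow> store \<Rightarrow> tree" where
  "eval_expr (Var x) s = s x"
| "eval_expr LeafE s = Leaf"
| "eval_expr (NodeE e f) s = Node (eval_expr e s) (eval_expr f s)"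
| "eval_expr (LeftE e) s = left (eval_expr e s)"
| "eval_expr (RightE e) s = right (eval_expr e s)"

fun cost_expr :: "expr \<Rightarrow> nat" where
  "cost_expr (Var x) = 1"
| "cost_expr LeafE = 1"
| "cost_expr (NodeE e f) = cost_expr e + cost_expr f + 1"
| "cost_expr (LeftE e) = cost_expr e + 1"
| "cost_expr (RightE e) = cost_expr e + 1"

text \<open>
  \<open>exec c s t s'\<close>: started in store \<open>s\<close>, the program \<open>c\<close> terminates in store \<open>s'\<close> after
  exactly \<open>t\<close> time units.
\<close>

inductive exec :: "com \<Rightarrow> store \<Rightarrow> nat \<Rightarrow> store \<Rightarrow> bool" where
  Skip: "exec Skip s 1 s"
| Assign: "exec (Assign x e) s (cost_expr e + 1) (s(x := eval_expr e s))"
| Seq: "exec c1 s t1 s' \<Longrightarrow> exec c2 s' t2 s'' \<Longrightarrow> exec (Seq c1 c2) s (t1 + t2) s''"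
| CondTrue: "eval_expr e s \<noteq> Leaf \<Longrightarrow> exec c1 s t s' \<Longrightarrow>
    exec (Cond e c1 c2) s (cost_expr e + 1 + t) s'"
| CondFalse: "eval_expr e s = Leaf \<Longrightarrow> exec c2 s t s' \<Longrightarrow>
    exec (Cond e c1 c2) s (cost_expr e + 1 + t) s'"
| WhileTrue: "eval_expr e s \<noteq> Leaf \<Longrightarrow> exec c s t1 s' \<Longrightarrow> exec (While e c) s' t2 s'' \<Longrightarrow>
    exec (While e c) s (cost_expr e + 1 + t1 + t2) s''"
| WhileFalse: "eval_expr e s = Leaf \<Longrightarrow> exec (While e c) s (cost_expr e + 1) s"

inductive_cases exec_Skip_cases: "exec Skip s t s'"
inductive_cases exec_Assign_cases: "exec (Assign x e) s t s'"
inductive_cases exec_Seq_cases: "exec (Seq c1 c2) s t s'"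
inductive_cases exec_Cond_cases: "exec (Cond e c1 c2) s t s'"
inductive_cases exec_While_cases: "exec (While e c) s t s'"

lemma exec_deterministic:
  assumes "exec c s t s'" "exec c s u s''"
  shows "u = t \<and> s'' = s'"
  using assms
proof (induction arbitrary: u s'' rule: exec.induct)
  case (Skip s)
  then show ?case by (rule exec_Skip_cases) simp
next
  case (Assign x e s)
  then show ?case by (rule exec_Assign_cases) simp
next
  case (Seq c1 s t1 s1 c2 t2 s2)
  from Seq.prems show ?case by (rule exec_Seq_cases) (metis Seq.IH)
next
  case (CondTrue e s c1 t s1 c2)
  from CondTrue.prems show ?case by (rule exec_Cond_cases) (use CondTrue.IH CondTrue.hyps(1) in \<open>(simp; metis)+\<close>)
next
  case (CondFalse e s c2 t s1 c1)
  from CondFalse.prems show ?case by (rule exec_Cond_cases) (use CondFalse.IH CondFalse.hyps(1) in \<open>(simp; metis)+\<close>)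
next
  case (WhileTrue e s c t1 s1 t2 s2)
  from WhileTrue.prems show ?case
    by (rule exec_While_cases) (use WhileTrue.IH WhileTrue.hyps(1) in \<open>(simp; metis)+\<close>)
next
  case (WhileFalse e s c)
  from WhileFalse.prems show ?case
    by (rule exec_While_cases) (use WhileFalse.hyps in simp_all)
qed

text \<open>The input is passed in variable \<open>0\<close>; all other variables are initially \<open>Leaf\<close>.\<close>

definition init_store :: "tree \<Rightarrow> store" where
  "init_store x = (\<lambda>_. Leaf)(0 := x)"


section \<open>Encodings\<close>

fun enc_list :: "tree list \<Rightarrow> tree" where
  "enc_list [] = Leaf"
| "enc_list (x # xs) = Node x (enc_list xs)"

definition enc_bool :: "bool \<Rightarrow> tree" where
  "enc_bool b = (if b then Node Leaf Leaf else Leaf)"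

text \<open>
  Graphs handed to an algorithm have vertex set \<open>{..<n}\<close> and are given by their adjacency
  matrix; vertex sets are given by their characteristic vector.
\<close>

definition enc_set :: "nat \<Rightarrow> nat set \<Rightarrow> tree" where
  "enc_set n X = enc_list (map (\<lambda>i. enc_bool (i \<in> X)) [0..<n])"

definition enc_graph :: "nat \<Rightarrow> nat set set \<Rightarrow> tree" where
  "enc_graph n E = enc_list (map (\<lambda>i. enc_set n {j. {i, j} \<in> E}) [0..<n])"

lemma enc_list_inject: "enc_list xs = enc_list ys \<Longrightarrow> xs = ys"
  by (induction xs arbitrary: ys; case_tac ys; simp)

lemma inj_on_enc_set: "inj_on (enc_set n) (Pow {..<n})"
proof (rule inj_onI)
  fix X Y assume sub: "X \<in> Pow {..<n}" "Y \<in> Pow {..<n}" and eq: "enc_set n X = enc_set n Y"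
  from eq have "\<forall>i\<in>set [0..<n]. enc_bool (i \<in> X) = enc_bool (i \<in> Y)"
    unfolding enc_set_def by (intro map_eq_conv[THEN iffD1] enc_list_inject)
  then have "i \<in> X \<longleftrightarrow> i \<in> Y" if "i < n" for i
    using that by (auto simp: enc_bool_def split: if_splits)
  with sub show "X = Y" by blast
qed


section \<open>Output-polynomial enumeration\<close>

text \<open>
  \<open>outputs_in c x ys t\<close>: on input \<open>x\<close>, the program \<open>c\<close> halts after \<open>t\<close> time units having
  output the sequence \<open>ys\<close>, which is left in variable \<open>0\<close>.
\<close>

definition outputs_in :: "com \<Rightarrow> tree \<Rightarrow> tree list \<Rightarrow> nat \<Rightarrow> bool" where
  "outputs_in c x ys t \<longleftrightarrow> (\<exists>s. exec c (init_store x) t s \<and> s 0 = enc_list ys)"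

definition bivariate_poly :: "nat \<Rightarrow> (nat \<Rightarrow> nat \<Rightarrow> nat) \<Rightarrow> nat \<Rightarrow> nat \<Rightarrow> nat" where
  "bivariate_poly d a x y = (\<Sum>i\<le>d. \<Sum>j\<le>d. a i j * x ^ i * y ^ j)"

text \<open>
  \<open>P\<close> is the class of admissible input graphs, \<open>S V E X\<close> says that \<open>X\<close> is a solution for
  the graph \<open>(V, E)\<close>. Nothing is required of the program on inputs outside \<open>P\<close>. The size
  of the input is the size of its encoding as a tree.
\<close>

definition output_polynomial_enumerable ::
    "(nat set \<Rightarrow> nat set set \<Rightarrow> bool) \<Rightarrow> (nat set \<Rightarrow> nat set set \<Rightarrow> nat set \<Rightarrow> bool) \<Rightarrow> bool" where
  "output_polynomial_enumerable P S \<longleftrightarrow>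
     (\<exists>c d a. \<forall>n E. P {..<n} E \<longrightarrow>
        (\<exists>Xs t. outputs_in c (enc_graph n E) (map (enc_set n) Xs) t \<and>
           distinct Xs \<and> set Xs = {X. S {..<n} E X} \<and>
           t \<le> bivariate_poly d a (size (enc_graph n E)) (card {X. S {..<n} E X})))"

end

theory Submission
  imports Defs
begin

text \<open>
  Given a graph on \<open>{..<n}\<close>, take a clique of \<open>M = 2 n + 2\<close> row vertices and an independent set of
  column vertices, column \<open>u < n\<close> being adjacent to row \<open>i < n\<close> iff \<open>u\<close> dominates \<open>i\<close>. Pendant
  vertices at the rows (and unused, isolated columns) are alliances by themselves, so no other globally minimal alliance contains
  one; they serve to raise every row degree to \<open>2 M\<close>, whence a row in an alliance needs \<open>M\<close>
  neighbours inside it. As the clique supplies at most \<open>M - 1\<close> of them, an alliance containing all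
  rows must contain a column from each closed neighbourhood, i.e. a dominating set. The \<open>n + 1\<close> rows
  adjacent to a single, special column force every alliance without pendant vertices to contain all
  rows: each of them needs all other rows, and the remaining rows and columns are too few to form
  an alliance without them. So besides polynomially many singletons the solutions are in bijection
  with the minimal dominating sets.
\<close>

section \<open>Polynomial bounds\<close>

text \<open>The constants come from one count. With \<open>M + 1\<close> columns, a row sees
  \<open>M - 1\<close> other rows and, per column index, either the column or a pendant, so its
  degree is \<open>2 * M\<close>. The alliance condition then asks for \<open>M\<close> inner
  neighbours, exactly one more than the clique can give, and the missing one is the dominating
  column. \<open>M\<close> itself must beat the \<open>2 * n + 1\<close> neighbours available to a
  row of index at most \<open>n\<close> from \<open>n + 1\<close> columns and \<open>n\<close> rows,
  whence \<open>2 * n + 2\<close>. The surplus solutions must be few because the given enumerator is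
  fast only relative to the number of its own solutions. They must also be recognisable: every
  wanted alliance contains the special column, which gets number \<open>n\<close>, and no surplus
  one does. So decoding is one lookup followed by truncation and never compares solutions. The other
  half of the work is the machine model. Programs for the reduction are not written out; tree
  functions are shown polynomial by closure rules in which a fold is the only loop.\<close>

definition poly_bounded :: "('a \<Rightarrow> nat) \<Rightarrow> ('a \<Rightarrow> nat) \<Rightarrow> bool" where
  "poly_bounded \<mu> h \<longleftrightarrow> (\<exists>k. \<forall>x. h x \<le> (\<mu> x + 2) ^ k)"

lemma poly_bounded_mono: "poly_bounded \<mu> h \<Longrightarrow> (\<And>x. g x \<le> h x) \<Longrightarrow> poly_bounded \<mu> g"
  unfolding poly_bounded_def by (meson le_trans)

text \<open>The base \<open>\<mu> x + 2\<close> is at least 2 even for inputs of size 0, so a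
  constant or a factor 2 can be absorbed into the exponent. A single power thus replaces polynomials
  with coefficients.\<close>

lemma poly_bounded_const: "poly_bounded \<mu> (\<lambda>_. c)"
  unfolding poly_bounded_def
proof (intro exI allI)
  fix x
  have "c \<le> 2 ^ c" by (simp add: less_imp_le)
  also have "\<dots> \<le> (\<mu> x + 2) ^ c" by (rule power_mono) auto
  finally show "c \<le> (\<mu> x + 2) ^ c" .
qed

lemma poly_bounded_self: "poly_bounded \<mu> \<mu>"
  unfolding poly_bounded_def by (rule exI[of _ 1]) simp

lemma poly_bounded_add:
  assumes "poly_bounded \<mu> g" "poly_bounded \<mu> h"
  shows "poly_bounded \<mu> (\<lambda>x. g x + h x)"
proof -
  obtain j k where j: "\<And>x. g x \<le> (\<mu> x + 2) ^ j" and k: "\<And>x. h x \<le> (\<mu> x + 2) ^ k"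
    using assms unfolding poly_bounded_def by blast
  have "g x + h x \<le> (\<mu> x + 2) ^ Suc (j + k)" for x
  proof -
    have "g x \<le> (\<mu> x + 2) ^ (j + k)"
      by (rule order_trans[OF j power_increasing]) auto
    moreover have "h x \<le> (\<mu> x + 2) ^ (j + k)"
      by (rule order_trans[OF k power_increasing]) auto
    ultimately have "g x + h x \<le> 2 * (\<mu> x + 2) ^ (j + k)" by simp
    also have "\<dots> \<le> (\<mu> x + 2) * (\<mu> x + 2) ^ (j + k)" by (rule mult_right_mono) auto
    finally show ?thesis by simp
  qed
  then show ?thesis unfolding poly_bounded_def by blast
qed

lemma poly_bounded_Suc: "poly_bounded \<mu> h \<Longrightarrow> poly_bounded \<mu> (\<lambda>x. Suc (h x))"
  using poly_bounded_add[OF _ poly_bounded_const[of _ 1]] by simp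

lemma poly_bounded_mult:
  assumes "poly_bounded \<mu> g" "poly_bounded \<mu> h"
  shows "poly_bounded \<mu> (\<lambda>x. g x * h x)"
proof -
  obtain j k where "\<And>x. g x \<le> (\<mu> x + 2) ^ j" and "\<And>x. h x \<le> (\<mu> x + 2) ^ k"
    using assms unfolding poly_bounded_def by blast
  then have "g x * h x \<le> (\<mu> x + 2) ^ (j + k)" for x
    by (simp add: power_add mult_mono)
  then show ?thesis unfolding poly_bounded_def by blast
qed

lemma poly_bounded_power: "poly_bounded \<mu> h \<Longrightarrow> poly_bounded \<mu> (\<lambda>x. h x ^ k)"
  by (induction k) (auto intro: poly_bounded_const[of _ 1, simplified] poly_bounded_mult)

lemma poly_bounded_comp:
  assumes "poly_bounded \<nu> h" "poly_bounded \<mu> (\<lambda>x. \<nu> (f x))"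
  shows "poly_bounded \<mu> (\<lambda>x. h (f x))"
proof -
  obtain k where k: "\<And>x. h x \<le> (\<nu> x + 2) ^ k"
    using assms(1) unfolding poly_bounded_def by blast
  have "poly_bounded \<mu> (\<lambda>x. (\<nu> (f x) + 2) ^ k)"
    by (intro poly_bounded_power poly_bounded_add assms(2) poly_bounded_const)
  then show ?thesis by (rule poly_bounded_mono) (rule k)
qed

lemmas poly_bounded_intros =
  poly_bounded_add poly_bounded_mult poly_bounded_power poly_bounded_const

text \<open>This lemma and its converse \<open>power_le_bivariate_poly\<close> translate between
  polynomials with coefficients, as used in the enumeration notion, and powers, which are easy to
  compose.\<close>

lemma bivariate_poly_le_power:
  "\<exists>k. \<forall>x y. bivariate_poly d a x y \<le> (x + y + 2) ^ k"
proof -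
  define A where "A = (\<Sum>i\<le>d. \<Sum>j\<le>d. a i j)"
  let ?\<mu> = "\<lambda>(x, y). x + y"
  have "poly_bounded ?\<mu> (\<lambda>p. A * (?\<mu> p + 2) ^ (d + d))"
    by (intro poly_bounded_intros poly_bounded_self)
  moreover have "bivariate_poly d a x y \<le> A * (x + y + 2) ^ (d + d)" for x y
    unfolding bivariate_poly_def A_def sum_distrib_right
  proof (intro sum_mono)
    fix i j assume ij: "i \<in> {..d}" "j \<in> {..d}"
    have "x ^ i \<le> (x + y + 2) ^ d"
      by (rule order_trans[OF power_mono[of x "x + y + 2"] power_increasing]) (use ij in auto)
    moreover have "y ^ j \<le> (x + y + 2) ^ d"
      by (rule order_trans[OF power_mono[of y "x + y + 2"] power_increasing]) (use ij in auto)
    ultimately have "x ^ i * y ^ j \<le> (x + y + 2) ^ (d + d)"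
      unfolding power_add by (rule mult_mono) auto
    then show "a i j * x ^ i * y ^ j \<le> a i j * (x + y + 2) ^ (d + d)"
      by (simp add: mult.assoc)
  qed
  ultimately have "poly_bounded (\<lambda>(x, y). x + y) (\<lambda>(x, y). bivariate_poly d a x y)"
    by (elim poly_bounded_mono) auto
  then show ?thesis unfolding poly_bounded_def by auto
qed

text \<open>Majorising \<open>x + y + 2\<close> by the product \<open>2 * (x + 1) * (y + 1)\<close>
  separates the variables, so two binomial expansions yield the coefficients on the full square of
  exponents.\<close>

lemma power_le_bivariate_poly:
  "\<exists>d a. \<forall>x y. (x + y + 2) ^ k \<le> bivariate_poly d a x y"
proof (intro exI allI)
  fix x y :: nat
  have "x + y + 2 \<le> 2 * (x + 1) * (y + 1)" by (simp add: algebra_simps)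
  then have "(x + y + 2) ^ k \<le> (2 * (x + 1) * (y + 1)) ^ k" by (rule power_mono) simp
  also have "\<dots> = 2 ^ k * ((x + 1) ^ k * (y + 1) ^ k)"
    unfolding power_mult_distrib by simp
  also have "\<dots> = bivariate_poly k (\<lambda>i j. 2 ^ k * (k choose i) * (k choose j)) x y"
  proof -
    have binom: "(z + 1) ^ k = (\<Sum>i\<le>k. (k choose i) * z ^ i)" for z :: nat
      using binomial[of z 1 k] by simp
    show ?thesis
      unfolding bivariate_poly_def binom[of x] binom[of y]
      unfolding sum_product
      unfolding sum_distrib_left
      by (intro sum.cong refl) (simp add: ac_simps)
  qed
  finally show "(x + y + 2) ^ k \<le> bivariate_poly k (\<lambda>i j. 2 ^ k * (k choose i) * (k choose j)) x y" .
qed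


section \<open>Polynomial-time tree functions\<close>

text \<open>
  Since trees are shared, a running time bound does not bound the size of the result, so the
  latter is required separately. Quantifying over \<open>m\<close> makes programs composable: registers
  from \<open>m\<close> on are scratch space.
\<close>

definition ptime :: "(tree \<Rightarrow> tree) \<Rightarrow> bool" where
  "ptime f \<longleftrightarrow> poly_bounded size (\<lambda>x. size (f x)) \<and>
     (\<forall>m x y. x < m \<longrightarrow> y < m \<longrightarrow> (\<exists>c T. poly_bounded size T \<and>
        (\<forall>s. \<exists>t s'. exec c s t s' \<and> t \<le> T (s x) \<and> s' y = f (s x) \<and>
           (\<forall>z<m. z \<noteq> y \<longrightarrow> s' z = s z))))"

lemma ptime_size: "ptime f \<Longrightarrow> poly_bounded size (\<lambda>x. size (f x))"
  unfolding ptime_def by blast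

lemma ptime_program:
  assumes "ptime f" "x < m" "y < m"
  obtains c T where "poly_bounded size T"
    "\<And>s. \<exists>t s'. exec c s t s' \<and> t \<le> T (s x) \<and> s' y = f (s x) \<and> (\<forall>z<m. z \<noteq> y \<longrightarrow> s' z = s z)"
  using assms unfolding ptime_def by blast

text \<open>The cost of an expression does not depend on the store, so one assignment runs in
  constant time.\<close>

lemma ptime_expr:
  assumes "poly_bounded size (\<lambda>x. size (f x))"
    and "\<And>x. \<exists>e. \<forall>s. eval_expr e s = f (s x)"
  shows "ptime f"
  unfolding ptime_def
proof (intro conjI allI impI assms(1))
  fix m x y :: nat assume "x < m" "y < m"
  obtain e where e: "\<And>s. eval_expr e s = f (s x)" using assms(2) by blast
  have "\<exists>t s'. exec (Assign y e) s t s' \<and> t \<le> cost_expr e + 1 \<and> s' y = f (s x) \<and>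
      (\<forall>z<m. z \<noteq> y \<longrightarrow> s' z = s z)" for s
    using exec.Assign[of y e s] e by (metis fun_upd_apply order_refl)
  then show "\<exists>c T. poly_bounded size T \<and> (\<forall>s. \<exists>t s'. exec c s t s' \<and> t \<le> T (s x) \<and>
      s' y = f (s x) \<and> (\<forall>z<m. z \<noteq> y \<longrightarrow> s' z = s z))"
    by (intro exI[of _ "Assign y e"] exI[of _ "\<lambda>_. cost_expr e + 1"]) (auto intro: poly_bounded_const)
qed

lemma size_left_le: "size (left t) \<le> size t"
  by (cases t) auto

lemma size_right_le: "size (right t) \<le> size t"
  by (cases t) auto

lemma ptime_id: "ptime (\<lambda>x. x)"
  by (rule ptime_expr) (auto intro: poly_bounded_self exI[of _ "Var _"])

lemma ptime_Leaf: "ptime (\<lambda>_. Leaf)"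
  by (rule ptime_expr) (auto intro: poly_bounded_const exI[of _ LeafE])

text \<open>The intermediate value goes to the first scratch register \<open>m\<close>, so both
  programs are taken with frame \<open>Suc m\<close>. The time of \<open>f\<close> is polynomial in
  the original input only because the size of \<open>g x\<close> is, which is the purpose of the
  size clause in \<open>ptime\<close>.\<close>

lemma ptime_comp:
  assumes f: "ptime f" and g: "ptime g"
  shows "ptime (\<lambda>x. f (g x))"
  unfolding ptime_def
proof (intro conjI allI impI)
  show "poly_bounded size (\<lambda>x. size (f (g x)))"
    using ptime_size[OF f] ptime_size[OF g] by (rule poly_bounded_comp)
next
  fix m x y :: nat assume xy: "x < m" "y < m"
  obtain cg Tg where Tg: "poly_bounded size Tg" and cg:
    "\<And>s. \<exists>t s'. exec cg s t s' \<and> t \<le> Tg (s x) \<and> s' m = g (s x) \<and> (\<forall>z<Suc m. z \<noteq> m \<longrightarrow> s' z = s z)"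
    by (rule ptime_program[OF g, of x "Suc m" m]) (use xy in auto)
  obtain cf Tf where Tf: "poly_bounded size Tf" and cf:
    "\<And>s. \<exists>t s'. exec cf s t s' \<and> t \<le> Tf (s m) \<and> s' y = f (s m) \<and> (\<forall>z<Suc m. z \<noteq> y \<longrightarrow> s' z = s z)"
    by (rule ptime_program[OF f, of m "Suc m" y]) (use xy in auto)
  show "\<exists>c T. poly_bounded size T \<and> (\<forall>s. \<exists>t s'. exec c s t s' \<and> t \<le> T (s x) \<and>
      s' y = f (g (s x)) \<and> (\<forall>z<m. z \<noteq> y \<longrightarrow> s' z = s z))"
  proof (rule exI, rule exI, intro conjI allI)
    show "poly_bounded size (\<lambda>x. Tg x + Tf (g x))"
      by (intro poly_bounded_add Tg poly_bounded_comp[OF Tf] ptime_size[OF g])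
  next
    fix s
    obtain t1 s1 where 1: "exec cg s t1 s1" "t1 \<le> Tg (s x)" "s1 m = g (s x)"
      "\<And>z. z < m \<Longrightarrow> s1 z = s z" using cg[of s] by auto
    obtain t2 s2 where 2: "exec cf s1 t2 s2" "t2 \<le> Tf (s1 m)" "s2 y = f (s1 m)"
      "\<And>z. z < m \<Longrightarrow> z \<noteq> y \<Longrightarrow> s2 z = s1 z" using cf[of s1] by auto
    show "\<exists>t s'. exec (Seq cg cf) s t s' \<and> t \<le> Tg (s x) + Tf (g (s x)) \<and>
      s' y = f (g (s x)) \<and> (\<forall>z<m. z \<noteq> y \<longrightarrow> s' z = s z)"
      using exec.Seq[OF 1(1) 2(1)] 1 2 by (intro exI[of _ "t1 + t2"] exI[of _ s2]) auto
  qed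
qed

lemma ptime_left: "ptime f \<Longrightarrow> ptime (\<lambda>x. left (f x))"
  by (rule ptime_comp, rule ptime_expr)
     (auto intro: poly_bounded_mono[OF poly_bounded_self] size_left_le exI[of _ "LeftE (Var _)"])

lemma ptime_right: "ptime f \<Longrightarrow> ptime (\<lambda>x. right (f x))"
  by (rule ptime_comp, rule ptime_expr)
     (auto intro: poly_bounded_mono[OF poly_bounded_self] size_right_le exI[of _ "RightE (Var _)"])

lemma ptime_Node:
  assumes f: "ptime f" and g: "ptime g"
  shows "ptime (\<lambda>x. Node (f x) (g x))"
  unfolding ptime_def
proof (intro conjI allI impI)
  show "poly_bounded size (\<lambda>x. size (Node (f x) (g x)))"
    by (rule poly_bounded_mono[of _ "\<lambda>x. size (f x) + size (g x) + 1"])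
       (intro poly_bounded_intros ptime_size[OF f] ptime_size[OF g], simp)
next
  fix m x y :: nat assume xy: "x < m" "y < m"
  \<comment> \<open>The results go to \<open>m\<close> and \<open>m + 1\<close>. With frame
    \<open>m + 2\<close> the first one survives the computation of the second.\<close>
  obtain cf Tf where Tf: "poly_bounded size Tf" and cf:
    "\<And>s. \<exists>t s'. exec cf s t s' \<and> t \<le> Tf (s x) \<and> s' m = f (s x) \<and> (\<forall>z<m+2. z \<noteq> m \<longrightarrow> s' z = s z)"
    by (rule ptime_program[OF f, of x "m+2" m]) (use xy in auto)
  obtain cg Tg where Tg: "poly_bounded size Tg" and cg:
    "\<And>s. \<exists>t s'. exec cg s t s' \<and> t \<le> Tg (s x) \<and> s' (m+1) = g (s x) \<and> (\<forall>z<m+2. z \<noteq> m+1 \<longrightarrow> s' z = s z)"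
    by (rule ptime_program[OF g, of x "m+2" "m+1"]) (use xy in auto)
  let ?e = "NodeE (Var m) (Var (m+1))"
  show "\<exists>c T. poly_bounded size T \<and> (\<forall>s. \<exists>t s'. exec c s t s' \<and> t \<le> T (s x) \<and>
      s' y = Node (f (s x)) (g (s x)) \<and> (\<forall>z<m. z \<noteq> y \<longrightarrow> s' z = s z))"
  proof (rule exI, rule exI, intro conjI allI)
    show "poly_bounded size (\<lambda>x. Tf x + (Tg x + 4))"
      by (intro poly_bounded_intros Tg Tf)
  next
    fix s
    obtain t1 s1 where 1: "exec cf s t1 s1" "t1 \<le> Tf (s x)" "s1 m = f (s x)"
      "\<And>z. z < m \<Longrightarrow> s1 z = s z" using cf[of s] by auto
    obtain t2 s2 where 2: "exec cg s1 t2 s2" "t2 \<le> Tg (s1 x)" "s2 (m+1) = g (s1 x)"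
      "\<And>z. z < m+1 \<Longrightarrow> s2 z = s1 z" using cg[of s1] by auto
    show "\<exists>t s'. exec (Seq cf (Seq cg (Assign y ?e))) s t s' \<and> t \<le> Tf (s x) + (Tg (s x) + 4) \<and>
      s' y = Node (f (s x)) (g (s x)) \<and> (\<forall>z<m. z \<noteq> y \<longrightarrow> s' z = s z)"
      using exec.Seq[OF 1(1) exec.Seq[OF 2(1) exec.Assign[of y ?e s2]]] 1 2 xy
      by (intro exI[of _ "t1 + (t2 + (cost_expr ?e + 1))"] exI[of _ "s2(y := eval_expr ?e s2)"]) auto
  qed
qed

lemma ptime_if_Leaf:
  assumes b: "ptime b" and f: "ptime f" and g: "ptime g"
  shows "ptime (\<lambda>x. if b x = Leaf then g x else f x)"
  unfolding ptime_def
proof (intro conjI allI impI)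
  show "poly_bounded size (\<lambda>x. size (if b x = Leaf then g x else f x))"
    by (rule poly_bounded_mono[of _ "\<lambda>x. size (f x) + size (g x)"])
       (intro poly_bounded_intros ptime_size[OF f] ptime_size[OF g], simp)
next
  fix m x y :: nat assume xy: "x < m" "y < m"
  obtain cb Tb where Tb: "poly_bounded size Tb" and cb:
    "\<And>s. \<exists>t s'. exec cb s t s' \<and> t \<le> Tb (s x) \<and> s' m = b (s x) \<and> (\<forall>z<Suc m. z \<noteq> m \<longrightarrow> s' z = s z)"
    by (rule ptime_program[OF b, of x "Suc m" m]) (use xy in auto)
  obtain cf Tf where Tf: "poly_bounded size Tf" and cf:
    "\<And>s. \<exists>t s'. exec cf s t s' \<and> t \<le> Tf (s x) \<and> s' y = f (s x) \<and> (\<forall>z<m. z \<noteq> y \<longrightarrow> s' z = s z)"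
    by (rule ptime_program[OF f xy]) auto
  obtain cg Tg where Tg: "poly_bounded size Tg" and cg:
    "\<And>s. \<exists>t s'. exec cg s t s' \<and> t \<le> Tg (s x) \<and> s' y = g (s x) \<and> (\<forall>z<m. z \<noteq> y \<longrightarrow> s' z = s z)"
    by (rule ptime_program[OF g xy]) auto
  show "\<exists>c T. poly_bounded size T \<and> (\<forall>s. \<exists>t s'. exec c s t s' \<and> t \<le> T (s x) \<and>
      s' y = (if b (s x) = Leaf then g (s x) else f (s x)) \<and> (\<forall>z<m. z \<noteq> y \<longrightarrow> s' z = s z))"
  proof (rule exI, rule exI, intro conjI allI)
    show "poly_bounded size (\<lambda>x. Tb x + (2 + (Tf x + Tg x)))"
      by (intro poly_bounded_intros Tg Tf Tb)
  next
    fix s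
    obtain t1 s1 where 1: "exec cb s t1 s1" "t1 \<le> Tb (s x)" "s1 m = b (s x)"
      "\<And>z. z < m \<Longrightarrow> s1 z = s z" using cb[of s] by auto
    obtain t2 s2 where 2: "exec cf s1 t2 s2" "t2 \<le> Tf (s1 x)" "s2 y = f (s1 x)"
      "\<And>z. z < m \<Longrightarrow> z \<noteq> y \<Longrightarrow> s2 z = s1 z" using cf[of s1] by auto
    obtain t3 s3 where 3: "exec cg s1 t3 s3" "t3 \<le> Tg (s1 x)" "s3 y = g (s1 x)"
      "\<And>z. z < m \<Longrightarrow> z \<noteq> y \<Longrightarrow> s3 z = s1 z" using cg[of s1] by auto
    show "\<exists>t s'. exec (Seq cb (Cond (Var m) cf cg)) s t s' \<and> t \<le> Tb (s x) + (2 + (Tf (s x) + Tg (s x))) \<and>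
      s' y = (if b (s x) = Leaf then g (s x) else f (s x)) \<and> (\<forall>z<m. z \<noteq> y \<longrightarrow> s' z = s z)"
    proof (cases "b (s x) = Leaf")
      case True
      have "exec (Cond (Var m) cf cg) s1 (cost_expr (Var m) + 1 + t3) s3"
        by (rule exec.CondFalse) (use True 1 3 in auto)
      from exec.Seq[OF 1(1) this] show ?thesis using True 1 3 xy
        by (intro exI[of _ "t1 + (cost_expr (Var m) + 1 + t3)"] exI[of _ s3]) auto
    next
      case False
      have "exec (Cond (Var m) cf cg) s1 (cost_expr (Var m) + 1 + t2) s2"
        by (rule exec.CondTrue) (use False 1 2 in auto)
      from exec.Seq[OF 1(1) this] show ?thesis using False 1 2 xy
        by (intro exI[of _ "t1 + (cost_expr (Var m) + 1 + t2)"] exI[of _ s2]) auto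
    qed
  qed
qed

text \<open>Every tree is read as the list along its right spine.\<close>

fun tfold :: "(tree \<Rightarrow> tree \<Rightarrow> tree) \<Rightarrow> tree \<Rightarrow> tree \<Rightarrow> tree" where
  "tfold f Leaf a = a"
| "tfold f (Node e l) a = tfold f l (f e a)"

lemma tfold_enc_list: "tfold f (enc_list xs) a = fold f xs a"
  by (induction xs arbitrary: a) auto

text \<open>The list elements are subtrees of \<open>l\<close>, so the bound \<open>S\<close>
  applies to each of them, and \<open>size l\<close> bounds the number of steps.\<close>

lemma size_tfold_le:
  assumes "\<And>e a. size e \<le> S \<Longrightarrow> size (f e a) \<le> size a + G" "size l \<le> S"
  shows "size (tfold f l a) \<le> size a + size l * G"
  using assms(2)
proof (induction l arbitrary: a)
  case (Node e l)
  have "size (tfold f l (f e a)) \<le> size (f e a) + size l * G" using Node by auto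
  also have "\<dots> \<le> size a + G + size l * G" using assms(1)[of e a] Node.prems by auto
  also have "\<dots> \<le> size a + size (Node e l) * G" by (simp add: algebra_simps)
  finally show ?case by simp
qed auto

text \<open>
  Each step may enlarge the accumulator by an amount that does not depend on the accumulator;
  without such a restriction, iterated doubling would be possible.
\<close>

lemma ptime_tfold:
  assumes st: "ptime (\<lambda>z. st (left z) (left (right z)) (right (right z)))"
    and l: "ptime l" and i: "ptime i"
    and g: "poly_bounded size g" and growth: "\<And>x e a. size (st x e a) \<le> size a + g (Node x e)"
  shows "ptime (\<lambda>x. tfold (st x) (l x) (i x))"
proof -
  obtain kg where kg: "\<And>x. g x \<le> (size x + 2) ^ kg" using g unfolding poly_bounded_def by blast
  \<comment> \<open>For a list element \<open>e\<close> the size of \<open>Node x e\<close> is at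
    most \<open>size x + size (l x) + 1\<close>; the \<open>2\<close> from
    \<open>poly_bounded\<close> makes this \<open>3\<close>. \<open>H\<close> will bound every
    accumulator that occurs.\<close>
  define G where "G = (\<lambda>x. (size x + size (l x) + 3) ^ kg)"
  define H where "H = (\<lambda>x. size (i x) + size (l x) * G x)"
  have G: "poly_bounded size G" unfolding G_def
    by (intro poly_bounded_intros poly_bounded_self ptime_size[OF l])
  have H: "poly_bounded size H" unfolding H_def
    by (intro poly_bounded_intros G ptime_size[OF l] ptime_size[OF i])
  have growth': "size (st x e a) \<le> size a + G x" if "size e \<le> size (l x)" for x e a
  proof -
    have "g (Node x e) \<le> (size (Node x e) + 2) ^ kg" by (rule kg)
    also have "\<dots> \<le> G x" unfolding G_def by (rule power_mono) (use that in auto)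
    finally show ?thesis using growth[of x e a] by linarith
  qed
  show ?thesis unfolding ptime_def
  proof (intro conjI allI impI)
    show "poly_bounded size (\<lambda>x. size (tfold (st x) (l x) (i x)))"
      using H by (rule poly_bounded_mono) (simp add: H_def size_tfold_le[OF growth'])
  next
    fix m x y :: nat assume xy: "x < m" "y < m"
    \<comment> \<open>Register \<open>m\<close> holds the rest of the list, \<open>m + 1\<close> the
      accumulator, and \<open>m + 2\<close> the packed argument of the step.\<close>
    obtain cl Tl where Tl: "poly_bounded size Tl" and cl:
      "\<And>s. \<exists>t s'. exec cl s t s' \<and> t \<le> Tl (s x) \<and> s' m = l (s x) \<and> (\<forall>z<m+3. z \<noteq> m \<longrightarrow> s' z = s z)"
      by (rule ptime_program[OF l, of x "m+3" m]) (use xy in auto)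
    obtain ci Ti where Ti: "poly_bounded size Ti" and ci:
      "\<And>s. \<exists>t s'. exec ci s t s' \<and> t \<le> Ti (s x) \<and> s' (m+1) = i (s x) \<and> (\<forall>z<m+3. z \<noteq> m+1 \<longrightarrow> s' z = s z)"
      by (rule ptime_program[OF i, of x "m+3" "m+1"]) (use xy in auto)
    obtain cs Ts where Ts: "poly_bounded size Ts" and cs:
      "\<And>s. \<exists>t s'. exec cs s t s' \<and> t \<le> Ts (s (m+2)) \<and>
        s' (m+1) = st (left (s (m+2))) (left (right (s (m+2)))) (right (right (s (m+2)))) \<and>
        (\<forall>z<m+3. z \<noteq> m+1 \<longrightarrow> s' z = s z)"
      by (rule ptime_program[OF st, of "m+2" "m+3" "m+1"]) (use xy in auto)
    obtain ks where ks: "\<And>x. Ts x \<le> (size x + 2) ^ ks" using Ts unfolding poly_bounded_def by blast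
    \<comment> \<open>\<open>B\<close> bounds the time of one step, which runs on
      \<open>Node x (Node e a)\<close> of size at most
      \<open>size x + size (l x) + H x + 2\<close>.\<close>
    define B where "B = (\<lambda>x. (size x + size (l x) + H x + 4) ^ ks)"
    have B: "poly_bounded size B" unfolding B_def
      by (intro poly_bounded_intros poly_bounded_self ptime_size[OF l] H)
    define e where "e = NodeE (Var x) (NodeE (LeftE (Var m)) (Var (m+1)))"
    define body where "body = Seq (Assign (m+2) e) (Seq cs (Assign m (RightE (Var m))))"
    \<comment> \<open>The last premise is a budget: the accumulator plus all growth still to come
      stays within \<open>H\<close>, which keeps each step within \<open>B\<close>. The
      \<open>12\<close> pays for test, packing and advancing (2 + 7 + 3), the final \<open>2\<close>
      for the failing test.\<close>
    have loop: "\<exists>t s'. exec (While (Var m) body) s t s' \<and> t \<le> size L * (B (s x) + 12) + 2 \<and>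
        s' (m+1) = tfold (st (s x)) L a \<and> (\<forall>z<m. s' z = s z)"
      if "s m = L" "s (m+1) = a" "size L \<le> size (l (s x))" "size a + size L * G (s x) \<le> H (s x)" for s L a
      using that
    proof (induction L arbitrary: s a)
      case Leaf
      have "exec (While (Var m) body) s (cost_expr (Var m) + 1) s"
        by (rule exec.WhileFalse) (use Leaf in auto)
      then show ?case using Leaf by (intro exI[of _ "cost_expr (Var m) + 1"] exI[of _ s]) auto
    next
      case (Node hd L)
      define s1 where "s1 = s(m+2 := eval_expr e s)"
      have s1: "s1 (m+2) = Node (s x) (Node hd a)" "\<And>z. z < m+2 \<Longrightarrow> s1 z = s z"
        using Node.prems xy by (auto simp: s1_def e_def)
      obtain t2 s2 where 2: "exec cs s1 t2 s2" "t2 \<le> Ts (s1 (m+2))" "s2 (m+1) = st (s x) hd a"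
        "\<And>z. z < m+1 \<Longrightarrow> s2 z = s z" using cs[of s1] s1 by auto
      define s3 where "s3 = s2(m := eval_expr (RightE (Var m)) s2)"
      have s3: "s3 m = L" "s3 (m+1) = st (s x) hd a" "\<And>z. z < m \<Longrightarrow> s3 z = s z"
        using Node.prems 2 by (auto simp: s3_def)
      have sx: "s3 x = s x" using s3(3) xy by simp
      have gr: "size (st (s x) hd a) \<le> size a + G (s x)"
        by (rule growth') (use Node.prems in auto)
      have "\<exists>t s'. exec (While (Var m) body) s3 t s' \<and> t \<le> size L * (B (s3 x) + 12) + 2 \<and>
          s' (m+1) = tfold (st (s3 x)) L (st (s x) hd a) \<and> (\<forall>z<m. s' z = s3 z)"
      proof (rule Node.IH(2)[OF s3(1,2)])
        show "size L \<le> size (l (s3 x))" using Node.prems sx by auto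
        have "size (st (s x) hd a) + size L * G (s x) \<le> size a + size (Node hd L) * G (s x)"
          using gr by (simp add: algebra_simps)
        then show "size (st (s x) hd a) + size L * G (s3 x) \<le> H (s3 x)"
          using Node.prems(4) sx by simp
      qed
      then obtain t4 s4 where 4: "exec (While (Var m) body) s3 t4 s4" "t4 \<le> size L * (B (s x) + 12) + 2"
        "s4 (m+1) = tfold (st (s x)) L (st (s x) hd a)" "\<And>z. z < m \<Longrightarrow> s4 z = s z"
        using s3 sx by auto
      have t2: "t2 \<le> B (s x)"
      proof -
        have "t2 \<le> (size (s1 (m+2)) + 2) ^ ks" using 2(2) ks order_trans by blast
        also have "\<dots> \<le> B (s x)" unfolding B_def
          by (rule power_mono) (use Node.prems s1(1) in auto)
        finally show ?thesis .
      qed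
      have b: "exec body s ((cost_expr e + 1) + (t2 + (cost_expr (RightE (Var m)) + 1))) s3"
        unfolding body_def s3_def
        by (rule exec.Seq[OF exec.Assign exec.Seq[OF 2(1)[unfolded s1_def] exec.Assign]])
      have "exec (While (Var m) body) s (cost_expr (Var m) + 1 +
          ((cost_expr e + 1) + (t2 + (cost_expr (RightE (Var m)) + 1))) + t4) s4"
        by (rule exec.WhileTrue[OF _ b 4(1)]) (use Node.prems in auto)
      moreover have "cost_expr (Var m) + 1 +
          ((cost_expr e + 1) + (t2 + (cost_expr (RightE (Var m)) + 1))) + t4
          \<le> size (Node hd L) * (B (s x) + 12) + 2"
        using t2 4(2) by (simp add: e_def algebra_simps)
      ultimately show ?case using 4(3,4)
        by (metis tfold.simps(2))
    qed
    show "\<exists>c T. poly_bounded size T \<and> (\<forall>s. \<exists>t s'. exec c s t s' \<and> t \<le> T (s x) \<and>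
        s' y = tfold (st (s x)) (l (s x)) (i (s x)) \<and> (\<forall>z<m. z \<noteq> y \<longrightarrow> s' z = s z))"
    proof (rule exI, rule exI, intro conjI allI)
      show "poly_bounded size (\<lambda>x. Tl x + (Ti x + ((size (l x) * (B x + 12) + 2) + 2)))"
        by (intro poly_bounded_intros Tl Ti B ptime_size[OF l])
    next
      fix s
      obtain t1 s1 where 1: "exec cl s t1 s1" "t1 \<le> Tl (s x)" "s1 m = l (s x)"
        "\<And>z. z < m \<Longrightarrow> s1 z = s z" using cl[of s] by auto
      obtain t2 s2 where 2: "exec ci s1 t2 s2" "t2 \<le> Ti (s x)" "s2 (m+1) = i (s x)" "s2 m = l (s x)"
        "\<And>z. z < m \<Longrightarrow> s2 z = s z" using ci[of s1] 1 xy by auto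
      have "s2 x = s x" using 2 xy by simp
      then obtain t3 s3 where 3: "exec (While (Var m) body) s2 t3 s3"
        "t3 \<le> size (l (s x)) * (B (s x) + 12) + 2"
        "s3 (m+1) = tfold (st (s x)) (l (s x)) (i (s x))" "\<And>z. z < m \<Longrightarrow> s3 z = s z"
        using loop[of s2 "l (s x)" "i (s x)"] 2 by (auto simp: H_def)
      let ?e = "Var (m+1)"
      show "\<exists>t s'. exec (Seq cl (Seq ci (Seq (While (Var m) body) (Assign y ?e)))) s t s' \<and>
        t \<le> Tl (s x) + (Ti (s x) + ((size (l (s x)) * (B (s x) + 12) + 2) + 2)) \<and>
        s' y = tfold (st (s x)) (l (s x)) (i (s x)) \<and> (\<forall>z<m. z \<noteq> y \<longrightarrow> s' z = s z)"
        using exec.Seq[OF 1(1) exec.Seq[OF 2(1) exec.Seq[OF 3(1) exec.Assign[of y ?e s3]]]] 1 2 3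
        by (intro exI[of _ "t1 + (t2 + (t3 + (cost_expr ?e + 1)))"] exI[of _ "s3(y := eval_expr ?e s3)"]) auto
    qed
  qed
qed

section \<open>Polynomial-time list operations\<close>

text \<open>Binary operations are handled as functions of a pair, so that the unary notion
  \<open>ptime\<close> suffices.\<close>

lemma ptime_comp2:
  assumes "ptime (\<lambda>z. F (left z) (right z))" "ptime f" "ptime g"
  shows "ptime (\<lambda>x. F (f x) (g x))"
  using ptime_comp[OF assms(1) ptime_Node[OF assms(2,3)]] by simp

section \<open>Polynomial-time decidable predicates\<close>

definition pdec :: "(tree \<Rightarrow> bool) \<Rightarrow> bool" where
  "pdec P \<longleftrightarrow> ptime (\<lambda>x. enc_bool (P x))"

lemma ptime_enc_bool: "pdec P \<Longrightarrow> ptime (\<lambda>x. enc_bool (P x))"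
  unfolding pdec_def .

lemma enc_bool_eq_Leaf [simp]: "enc_bool b = Leaf \<longleftrightarrow> \<not> b"
  by (simp add: enc_bool_def)

lemma ptime_if:
  assumes "pdec P" "ptime f" "ptime g"
  shows "ptime (\<lambda>x. if P x then f x else g x)"
proof -
  have "(if enc_bool (P x) = Leaf then g x else f x) = (if P x then f x else g x)" for x
    by simp
  then show ?thesis using ptime_if_Leaf[OF assms[unfolded pdec_def]] by presburger
qed

lemma pdec_if:
  assumes "pdec P" "pdec Q" "pdec R"
  shows "pdec (\<lambda>x. if P x then Q x else R x)"
  using ptime_if[OF assms[unfolded pdec_def[of Q] pdec_def[of R]]]
  unfolding pdec_def by (simp add: if_distrib)

lemma pdec_is_Leaf:
  assumes "ptime f"
  shows "pdec (\<lambda>x. f x = Leaf)"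
  using ptime_if_Leaf[OF assms ptime_Leaf ptime_Node[OF ptime_Leaf ptime_Leaf]]
  unfolding pdec_def enc_bool_def .

lemma pdec_True: "pdec (\<lambda>_. True)"
  unfolding pdec_def enc_bool_def by (simp add: ptime_Node ptime_Leaf)

lemma pdec_False: "pdec (\<lambda>_. False)"
  unfolding pdec_def enc_bool_def by (simp add: ptime_Leaf)

lemma pdec_not: "pdec P \<Longrightarrow> pdec (\<lambda>x. \<not> P x)"
  using pdec_if[OF _ pdec_False pdec_True, of P] by (simp add: if_bool_eq_conj)

lemma pdec_conj: "pdec P \<Longrightarrow> pdec Q \<Longrightarrow> pdec (\<lambda>x. P x \<and> Q x)"
  using pdec_if[OF _ _ pdec_False, of P Q] by (simp add: if_bool_eq_conj conj_commute cong: conj_cong)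

lemma pdec_disj: "pdec P \<Longrightarrow> pdec Q \<Longrightarrow> pdec (\<lambda>x. P x \<or> Q x)"
  using pdec_if[OF _ pdec_True, of P Q] by (simp add: if_bool_eq_disj cong: disj_cong)

lemma pdec_comp2:
  assumes "pdec (\<lambda>z. P (left z) (right z))" "ptime f" "ptime g"
  shows "pdec (\<lambda>x. P (f x) (g x))"
  using ptime_comp2[of "\<lambda>x y. enc_bool (P x y)"] assms unfolding pdec_def .

lemmas ptime_intros =
  ptime_id ptime_Leaf ptime_Node ptime_left ptime_right ptime_if ptime_enc_bool
  pdec_if pdec_is_Leaf pdec_not pdec_conj pdec_disj

section \<open>Reversal, concatenation, map and filter\<close>

definition trev :: "tree \<Rightarrow> tree" where
  "trev l = tfold Node l Leaf"

lemma ptime_trev: "ptime f \<Longrightarrow> ptime (\<lambda>x. trev (f x))"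
  unfolding trev_def
  by (rule ptime_tfold[where st = "\<lambda>_. Node" and g = "\<lambda>x. size x + 1"])
     (auto intro!: ptime_intros poly_bounded_Suc poly_bounded_self)

lemma fold_Node: "fold Node xs (enc_list ys) = enc_list (rev xs @ ys)"
  by (induction xs arbitrary: ys) (auto simp flip: enc_list.simps)

lemma trev_enc_list [simp]: "trev (enc_list xs) = enc_list (rev xs)"
  using fold_Node[of xs "[]"] by (simp add: trev_def tfold_enc_list)

definition tappend :: "tree \<Rightarrow> tree \<Rightarrow> tree" where
  "tappend l l' = tfold Node (trev l) l'"

lemma ptime_tappend: "ptime f \<Longrightarrow> ptime g \<Longrightarrow> ptime (\<lambda>x. tappend (f x) (g x))"
  unfolding tappend_def
  by (rule ptime_tfold[where st = "\<lambda>_. Node" and g = "\<lambda>x. size x + 1"])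
     (auto intro!: ptime_intros ptime_trev poly_bounded_Suc poly_bounded_self)

lemma tappend_enc_list [simp]: "tappend (enc_list xs) (enc_list ys) = enc_list (xs @ ys)"
  using fold_Node[of "rev xs" ys] by (simp add: tappend_def tfold_enc_list)

lemma size_tfold_Node: "size (tfold Node l a) = size l + size a"
  by (induction l arbitrary: a) auto

lemma size_tappend: "size (tappend l l') = size l + size l'"
  by (simp add: tappend_def trev_def size_tfold_Node)

definition tconcat :: "tree \<Rightarrow> tree" where
  "tconcat ls = tfold (\<lambda>e a. tappend a e) ls Leaf"

text \<open>Although each step traverses the accumulator, it enlarges it by exactly the size of the
  appended element, as the growth condition of \<open>ptime_tfold\<close> demands.\<close>

lemma ptime_tconcat: "ptime f \<Longrightarrow> ptime (\<lambda>x. tconcat (f x))"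
  unfolding tconcat_def
  by (rule ptime_tfold[where st = "\<lambda>_ e a. tappend a e" and g = size])
     (auto intro!: ptime_intros ptime_tappend poly_bounded_self simp: size_tappend)

lemma fold_tappend:
  "fold (\<lambda>e a. tappend a e) (map enc_list xss) (enc_list ys) = enc_list (ys @ concat xss)"
  by (induction xss arbitrary: ys) auto

lemma tconcat_enc_list [simp]: "tconcat (enc_list (map enc_list xss)) = enc_list (concat xss)"
  using fold_tappend[of xss "[]"] by (simp add: tconcat_def tfold_enc_list)

text \<open>A fold pushes its results in reverse order, hence the outer \<open>trev\<close>.\<close>

definition tmap :: "(tree \<Rightarrow> tree) \<Rightarrow> tree \<Rightarrow> tree" where
  "tmap f l = trev (tfold (\<lambda>e. Node (f e)) l Leaf)"

text \<open>The mapped function receives the whole input \<open>x\<close> as a parameter, which is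
  what makes nested maps and maps over a graph-dependent function expressible.\<close>

lemma ptime_tmap:
  assumes "ptime (\<lambda>z. F (left z) (right z))" "ptime l"
  shows "ptime (\<lambda>x. tmap (F x) (l x))"
  unfolding tmap_def
proof (rule ptime_trev, rule ptime_tfold[where st = "\<lambda>x e. Node (F x e)" and
      g = "\<lambda>z. size (F (left z) (right z)) + 1", OF _ assms(2) ptime_Leaf])
  have "ptime (\<lambda>z. F (left z) (left (right z)))"
    by (rule ptime_comp2[where F = F, OF assms(1)]) (intro ptime_intros)+
  then show "ptime (\<lambda>z. Node (F (left z) (left (right z))) (right (right z)))"
    by (intro ptime_Node ptime_right ptime_id)
  show "poly_bounded size (\<lambda>z. size (F (left z) (right z)) + 1)"
    by (intro poly_bounded_intros ptime_size[OF assms(1)])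
qed auto

lemma fold_Node_map: "fold (\<lambda>e. Node (f e)) xs (enc_list ys) = enc_list (rev (map f xs) @ ys)"
  by (induction xs arbitrary: ys) (auto simp flip: enc_list.simps)

lemma tmap_enc_list [simp]: "tmap f (enc_list xs) = enc_list (map f xs)"
  using fold_Node_map[of f xs "[]"] by (simp add: tmap_def tfold_enc_list)

definition tfilter :: "(tree \<Rightarrow> bool) \<Rightarrow> tree \<Rightarrow> tree" where
  "tfilter P l = trev (tfold (\<lambda>e a. if P e then Node e a else a) l Leaf)"

lemma ptime_tfilter:
  assumes "pdec (\<lambda>z. P (left z) (right z))" "ptime l"
  shows "ptime (\<lambda>x. tfilter (P x) (l x))"
  unfolding tfilter_def
proof (rule ptime_trev, rule ptime_tfold[where st = "\<lambda>x e a. if P x e then Node e a else a" and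
      g = "\<lambda>z. size z + 1", OF _ assms(2) ptime_Leaf])
  have "pdec (\<lambda>z. P (left z) (left (right z)))"
    by (rule pdec_comp2[where P = P, OF assms(1)]) (intro ptime_intros)+
  then show "ptime (\<lambda>z. if P (left z) (left (right z)) then Node (left (right z)) (right (right z))
      else right (right z))"
    by (intro ptime_if ptime_Node ptime_left ptime_right ptime_id)
  show "poly_bounded size (\<lambda>z. size z + 1)"
    by (intro poly_bounded_intros poly_bounded_self)
qed auto

lemma fold_Node_filter:
  "fold (\<lambda>e a. if P e then Node e a else a) xs a = fold Node (filter P xs) a"
  by (induction xs arbitrary: a) auto

lemma tfilter_enc_list [simp]: "tfilter P (enc_list xs) = enc_list (filter P xs)"
  using fold_Node[of "filter P xs" "[]"] by (simp add: tfilter_def tfold_enc_list fold_Node_filter)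

text \<open>Only the length of the right spine of \<open>n\<close> matters, so any list can serve as
  a counter; \<open>trange\<close> uses its accumulator as one.\<close>

definition tdrop :: "tree \<Rightarrow> tree \<Rightarrow> tree" where
  "tdrop n l = tfold (\<lambda>_. right) n l"

lemma ptime_tdrop: "ptime f \<Longrightarrow> ptime g \<Longrightarrow> ptime (\<lambda>x. tdrop (f x) (g x))"
  unfolding tdrop_def
  by (rule ptime_tfold[where st = "\<lambda>_ _. right" and g = "\<lambda>_. 0"])
     (auto intro!: ptime_intros poly_bounded_const size_right_le)

lemma right_enc_list [simp]: "right (enc_list xs) = enc_list (tl xs)"
  by (cases xs) auto

lemma tdrop_enc_list [simp]: "tdrop (enc_list xs) (enc_list ys) = enc_list (drop (length xs) ys)"
  by (induction xs arbitrary: ys) (auto simp: tdrop_def drop_Suc)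

lemma size_tdrop_le: "size (tdrop n l) \<le> size l"
proof -
  have "size (tfold (\<lambda>_. right) n l) \<le> size l + size n * 0"
    by (rule size_tfold_le[of "size n"]) (auto simp: size_right_le)
  then show ?thesis by (simp add: tdrop_def)
qed

section \<open>Unary numbers, indexing and comparison\<close>

definition unary :: "nat \<Rightarrow> tree" where
  "unary n = enc_list (replicate n Leaf)"

definition tnth :: "tree \<Rightarrow> tree \<Rightarrow> tree" where
  "tnth l i = left (tdrop i l)"

lemma ptime_tnth: "ptime f \<Longrightarrow> ptime g \<Longrightarrow> ptime (\<lambda>x. tnth (f x) (g x))"
  unfolding tnth_def by (intro ptime_intros ptime_tdrop)

lemma tnth_enc_list [simp]: "i < length xs \<Longrightarrow> tnth (enc_list xs) (unary i) = xs ! i"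
  by (simp add: tnth_def unary_def flip: Cons_nth_drop_Suc)

definition tlength :: "tree \<Rightarrow> tree" where
  "tlength l = tmap (\<lambda>_. Leaf) l"

lemma ptime_tlength: "ptime f \<Longrightarrow> ptime (\<lambda>x. tlength (f x))"
  unfolding tlength_def by (intro ptime_tmap ptime_intros)

lemma tlength_enc_list [simp]: "tlength (enc_list xs) = unary (length xs)"
  by (simp add: tlength_def unary_def map_replicate_const)

text \<open>Comparison by truncated subtraction, since the language can test only for
  \<open>Leaf\<close>.\<close>

definition tle :: "tree \<Rightarrow> tree \<Rightarrow> bool" where
  "tle m n \<longleftrightarrow> tdrop n m = Leaf"

lemma pdec_tle: "ptime f \<Longrightarrow> ptime g \<Longrightarrow> pdec (\<lambda>x. tle (f x) (g x))"
  unfolding tle_def by (intro ptime_intros ptime_tdrop)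

lemma enc_list_eq_Leaf [simp]: "enc_list xs = Leaf \<longleftrightarrow> xs = []"
  by (cases xs) auto

lemma tle_unary [simp]: "tle (unary m) (unary n) \<longleftrightarrow> m \<le> n"
  by (simp add: tle_def unary_def)

definition teq :: "tree \<Rightarrow> tree \<Rightarrow> bool" where
  "teq m n \<longleftrightarrow> tle m n \<and> tle n m"

lemma pdec_teq: "ptime f \<Longrightarrow> ptime g \<Longrightarrow> pdec (\<lambda>x. teq (f x) (g x))"
  unfolding teq_def by (intro ptime_intros pdec_tle)

lemma teq_unary [simp]: "teq (unary m) (unary n) \<longleftrightarrow> m = n"
  by (auto simp: teq_def)

text \<open>With \<open>k\<close> entries already present, the next one is \<open>n - Suc k\<close>,
  obtained by cutting \<open>k + 1\<close> nodes off \<open>n\<close>. Descending production in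
  front of the accumulator gives ascending order without reversal, and cutting from \<open>n\<close>
  bounds the growth independently of the accumulator.\<close>

definition trange :: "tree \<Rightarrow> tree" where
  "trange n = tfold (\<lambda>_ a. Node (right (tdrop a n)) a) n Leaf"

lemma ptime_trange:
  assumes "ptime f"
  shows "ptime (\<lambda>x. trange (f x))"
proof -
  have "ptime (\<lambda>n. tfold (\<lambda>_ a. Node (right (tdrop a n)) a) n Leaf)"
  proof (rule ptime_tfold[where st = "\<lambda>n _ a. Node (right (tdrop a n)) a" and g = "\<lambda>z. size z + 1"])
    show "size (Node (right (tdrop a n)) a) \<le> size a + (size (Node n e) + 1)" for n e a
      using size_right_le[of "tdrop a n"] size_tdrop_le[of a n] by simp
  qed (intro ptime_intros ptime_tdrop poly_bounded_intros poly_bounded_self)+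
  then have "ptime trange" by (simp add: trange_def[abs_def])
  then show ?thesis using assms by (rule ptime_comp)
qed

lemma trange_unary [simp]: "trange (unary n) = enc_list (map unary [0..<n])"
proof -
  have "fold (\<lambda>_ a. Node (right (tdrop a (unary n))) a) (replicate k Leaf) Leaf =
      enc_list (map unary [n - k..<n])" if "k \<le> n" for k
    using that
  proof (induction k)
    case (Suc k)
    have right_tdrop: "right (tdrop (enc_list (map unary [n - k..<n])) (unary n)) = unary (n - Suc k)"
      using Suc.prems by (simp add: unary_def tl_drop flip: drop_Suc)
    have "fold (\<lambda>_ a. Node (right (tdrop a (unary n))) a) (replicate (Suc k) Leaf) Leaf =
        Node (unary (n - Suc k)) (enc_list (map unary [n - k..<n]))"
      using Suc right_tdrop by (simp flip: replicate_append_same)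
    also have "\<dots> = enc_list (map unary ((n - Suc k) # [n - k..<n]))" by simp
    also have "(n - Suc k) # [n - k..<n] = [n - Suc k..<n]"
      using Suc.prems by (simp add: upt_rec[of "n - Suc k"] Suc_diff_Suc)
    finally show ?case .
  qed simp
  from this[of n] show ?thesis
    by (simp add: trange_def tfold_enc_list unary_def)
qed

lemmas ptime_list_intros =
  ptime_tappend ptime_tconcat ptime_tmap ptime_tfilter ptime_tnth ptime_tlength pdec_tle
  pdec_teq ptime_trange


section \<open>Reductions between enumeration problems\<close>

fun expr_bound :: "expr \<Rightarrow> nat" where
  "expr_bound (Var x) = Suc x"
| "expr_bound LeafE = 0"
| "expr_bound (NodeE e f) = max (expr_bound e) (expr_bound f)"
| "expr_bound (LeftE e) = expr_bound e"
| "expr_bound (RightE e) = expr_bound e"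

fun com_bound :: "com \<Rightarrow> nat" where
  "com_bound Skip = 0"
| "com_bound (Assign x e) = max (Suc x) (expr_bound e)"
| "com_bound (Seq c d) = max (com_bound c) (com_bound d)"
| "com_bound (Cond e c d) = max (expr_bound e) (max (com_bound c) (com_bound d))"
| "com_bound (While e c) = max (expr_bound e) (com_bound c)"

lemma eval_expr_cong:
  "expr_bound e \<le> m \<Longrightarrow> (\<And>z. z < m \<Longrightarrow> s z = s' z) \<Longrightarrow> eval_expr e s = eval_expr e s'"
  by (induction e) auto

text \<open>The given enumerator is a black box whose behaviour is known only from
  \<open>init_store\<close>. A program neither reads nor writes registers from its bound on, so it
  behaves identically when other data is kept there.\<close>

lemma exec_frame:
  assumes "exec c s t s'" "com_bound c \<le> m" "\<And>z. z < m \<Longrightarrow> r z = s z"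
  shows "exec c r t (\<lambda>z. if z < m then s' z else r z)"
  using assms
proof (induction arbitrary: r rule: exec.induct)
  case (Skip s)
  then have "(\<lambda>z. if z < m then s z else r z) = r" by auto
  then show ?case using exec.Skip[of r] by simp
next
  case (Assign x e s)
  then have "eval_expr e r = eval_expr e s" by (intro eval_expr_cong[of e m]) auto
  then have "(\<lambda>z. if z < m then (s(x := eval_expr e s)) z else r z) = r(x := eval_expr e r)"
    using Assign by auto
  then show ?case using exec.Assign[of x e r] by simp
next
  case (Seq c1 s t1 s1 c2 t2 s2)
  let ?r = "\<lambda>z. if z < m then s1 z else r z"
  have "exec c1 r t1 ?r" using Seq by auto
  moreover have "exec c2 ?r t2 (\<lambda>z. if z < m then s2 z else ?r z)"
    using Seq by (intro Seq.IH(2)) auto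
  moreover have "(\<lambda>z. if z < m then s2 z else ?r z) = (\<lambda>z. if z < m then s2 z else r z)" by auto
  ultimately show ?case by (auto intro: exec.Seq)
next
  case (CondTrue e s c1 t s1 c2)
  then have "eval_expr e r = eval_expr e s" by (intro eval_expr_cong[of e m]) auto
  then show ?case
    using exec.CondTrue[OF _ CondTrue.IH[of r], of e c2] CondTrue by auto
next
  case (CondFalse e s c2 t s1 c1)
  then have "eval_expr e r = eval_expr e s" by (intro eval_expr_cong[of e m]) auto
  then show ?case
    using exec.CondFalse[OF _ CondFalse.IH[of r], of e c1] CondFalse by auto
next
  case (WhileTrue e s c t1 s1 t2 s2)
  let ?r = "\<lambda>z. if z < m then s1 z else r z"
  have e: "eval_expr e r = eval_expr e s"
    using WhileTrue by (intro eval_expr_cong[of e m]) auto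
  have "exec c r t1 ?r" using WhileTrue by auto
  moreover have "exec (While e c) ?r t2 (\<lambda>z. if z < m then s2 z else ?r z)"
    using WhileTrue by (intro WhileTrue.IH(2)) auto
  moreover have "(\<lambda>z. if z < m then s2 z else ?r z) = (\<lambda>z. if z < m then s2 z else r z)" by auto
  ultimately show ?case
    using e WhileTrue.hyps(1) exec.WhileTrue[of e r c t1 ?r t2] by simp
next
  case (WhileFalse e s c)
  have "eval_expr e r = eval_expr e s"
    using WhileFalse by (intro eval_expr_cong[of e m]) auto
  moreover have "(\<lambda>z. if z < m then s z else r z) = r" using WhileFalse by auto
  ultimately show ?case using WhileFalse.hyps exec.WhileFalse[of e r c] by simp
qed

section \<open>Sizes of encodings\<close>

lemma size_enc_list: "size (enc_list xs) = length xs + (\<Sum>x\<leftarrow>xs. size x)"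
  by (induction xs) auto

lemma size_enc_set_le: "size (enc_set n X) \<le> 2 * n"
proof -
  have "(\<Sum>i\<leftarrow>[0..<n]. size (enc_bool (i \<in> X))) \<le> (\<Sum>i\<leftarrow>[0..<n]. 1)"
    by (rule sum_list_mono) (simp add: enc_bool_def)
  also have "\<dots> = n" by (simp add: sum_list_triv)
  finally show ?thesis by (simp add: enc_set_def size_enc_list comp_def)
qed

lemma size_enc_graph_ge: "n \<le> size (enc_graph n E)"
  by (simp add: enc_graph_def size_enc_list)

lemma size_enc_sets_le: "size (enc_list (map (enc_set n) Xs)) \<le> length Xs * (2 * n + 1)"
proof -
  have "(\<Sum>X\<leftarrow>Xs. size (enc_set n X)) \<le> (\<Sum>X\<leftarrow>Xs. 2 * n)"
    by (rule sum_list_mono) (rule size_enc_set_le)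
  also have "\<dots> = length Xs * (2 * n)" by (simp add: sum_list_triv)
  finally show ?thesis by (simp add: size_enc_list comp_def)
qed

text \<open>A surplus of \<open>N\<close> solutions is harmless: \<open>N\<close> is at most the
  size of the reduced encoding, hence polynomial in the input. The decoder \<open>g\<close> is given
  the original graph beside the output list, and it must cope with any order in which the solutions
  are listed.\<close>

lemma output_polynomial_enumerable_reduction:
  assumes enum: "output_polynomial_enumerable P S" and f: "ptime f" and g: "ptime g"
    and red: "\<And>n E. P' {..<n} E \<Longrightarrow> \<exists>N E'. P {..<N} E' \<and> f (enc_graph n E) = enc_graph N E' \<and>
      card {X. S {..<N} E' X} \<le> card {X. S' {..<n} E X} + N \<and>
      (\<forall>Xs. distinct Xs \<longrightarrow> set Xs = {X. S {..<N} E' X} \<longrightarrow>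
        (\<exists>Ys. g (Node (enc_graph n E) (enc_list (map (enc_set N) Xs))) = enc_list (map (enc_set n) Ys) \<and>
          distinct Ys \<and> set Ys = {X. S' {..<n} E X}))"
  shows "output_polynomial_enumerable P' S'"
proof -
  obtain c d a where c: "\<And>N E. P {..<N} E \<Longrightarrow> \<exists>Xs t.
      outputs_in c (enc_graph N E) (map (enc_set N) Xs) t \<and> distinct Xs \<and> set Xs = {X. S {..<N} E X} \<and>
      t \<le> bivariate_poly d a (size (enc_graph N E)) (card {X. S {..<N} E X})"
    using enum unfolding output_polynomial_enumerable_def by metis
  obtain kc where kc: "\<And>x y. bivariate_poly d a x y \<le> (x + y + 2) ^ kc"
    using bivariate_poly_le_power by blast
  \<comment> \<open>Register \<open>m\<close> keeps the input: it lies beyond the registers of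
    \<open>c\<close>, and the \<open>Suc\<close> keeps it distinct from register
    \<open>0\<close>.\<close>
  define m where "m = Suc (com_bound c)"
  \<comment> \<open>With frame \<open>Suc m\<close> the registers strictly between \<open>0\<close>
    and \<open>m\<close> stay \<open>Leaf\<close>, so below \<open>m\<close> the store looks to
    \<open>c\<close> like a fresh one holding the reduced graph.\<close>
  obtain cf Tf where Tf: "poly_bounded size Tf" and cf:
    "\<And>s. \<exists>t s'. exec cf s t s' \<and> t \<le> Tf (s m) \<and> s' 0 = f (s m) \<and> (\<forall>z<Suc m. z \<noteq> 0 \<longrightarrow> s' z = s z)"
    by (rule ptime_program[OF f, of m "Suc m" 0]) auto
  \<comment> \<open>Frame 2 is enough: after the enumeration only the pair in register
    \<open>1\<close> is read, so everything from register \<open>2\<close> on may be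
    overwritten.\<close>
  obtain cg Tg where Tg: "poly_bounded size Tg" and cg:
    "\<And>s. \<exists>t s'. exec cg s t s' \<and> t \<le> Tg (s 1) \<and> s' 0 = g (s 1) \<and> (\<forall>z<2. z \<noteq> 0 \<longrightarrow> s' z = s z)"
    by (rule ptime_program[OF g, of 1 2 0]) auto
  obtain kf where kf: "\<And>x. Tf x \<le> (size x + 2) ^ kf" using Tf unfolding poly_bounded_def by blast
  obtain kg where kg: "\<And>x. Tg x \<le> (size x + 2) ^ kg" using Tg unfolding poly_bounded_def by blast
  obtain ks where ks: "\<And>x. size (f x) \<le> (size x + 2) ^ ks"
    using ptime_size[OF f] unfolding poly_bounded_def by blast
  define F where "F = (\<lambda>x. (x + 2) ^ ks :: nat)"
  \<comment> \<open>The summands bound, in order: saving the input, the reduction, the enumerator on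
    input size \<open>F x\<close> with \<open>y + F x\<close> solutions, forming the pair, and
    decoding a pair whose list has at most \<open>y + F x\<close> vectors of size
    \<open>2 * F x\<close>.\<close>
  define T where "T = (\<lambda>x y. 2 + (x + 2) ^ kf + (F x + (y + F x) + 2) ^ kc + 4 +
    (x + (y + F x) * (2 * F x + 1) + 1 + 2) ^ kg)"
  let ?\<mu> = "\<lambda>p. fst p + snd p"
  have "poly_bounded ?\<mu> fst" "poly_bounded ?\<mu> snd"
    by (rule poly_bounded_mono[OF poly_bounded_self], simp)+
  then have "poly_bounded ?\<mu> (\<lambda>p. T (fst p) (snd p))"
    unfolding T_def F_def by (intro poly_bounded_intros)
  then obtain k where k: "\<And>x y. T x y \<le> (x + y + 2) ^ k"
    unfolding poly_bounded_def by force
  obtain d' a' where d': "\<And>x y. (x + y + 2) ^ k \<le> bivariate_poly d' a' x y"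
    using power_le_bivariate_poly by blast
  define prog where "prog = Seq (Assign m (Var 0)) (Seq cf (Seq c
    (Seq (Assign 1 (NodeE (Var m) (Var 0))) cg)))"
  have "\<exists>Ys t. outputs_in prog (enc_graph n E) (map (enc_set n) Ys) t \<and> distinct Ys \<and>
      set Ys = {X. S' {..<n} E X} \<and>
      t \<le> bivariate_poly d' a' (size (enc_graph n E)) (card {X. S' {..<n} E X})"
    if P': "P' {..<n} E" for n E
  proof -
    obtain N E' where P: "P {..<N} E'" and fG: "f (enc_graph n E) = enc_graph N E'"
      and card: "card {X. S {..<N} E' X} \<le> card {X. S' {..<n} E X} + N"
      and dec: "\<And>Xs. distinct Xs \<Longrightarrow> set Xs = {X. S {..<N} E' X} \<Longrightarrow>
        \<exists>Ys. g (Node (enc_graph n E) (enc_list (map (enc_set N) Xs))) = enc_list (map (enc_set n) Ys) \<and>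
          distinct Ys \<and> set Ys = {X. S' {..<n} E X}"
      using red[OF P'] by metis
    obtain Xs t r where Xs: "exec c (init_store (enc_graph N E')) t r"
      "r 0 = enc_list (map (enc_set N) Xs)" "distinct Xs" "set Xs = {X. S {..<N} E' X}"
      "t \<le> bivariate_poly d a (size (enc_graph N E')) (card {X. S {..<N} E' X})"
      using c[OF P] unfolding outputs_in_def by blast
    obtain Ys where Ys: "g (Node (enc_graph n E) (enc_list (map (enc_set N) Xs))) = enc_list (map (enc_set n) Ys)"
      "distinct Ys" "set Ys = {X. S' {..<n} E X}"
      using dec[OF Xs(3,4)] by blast
    let ?x = "size (enc_graph n E)" and ?y = "card {X. S' {..<n} E X}"
    define s0 where "s0 = init_store (enc_graph n E)"
    define s1 where "s1 = s0(m := eval_expr (Var 0) s0)"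
    obtain t2 s2 where 2: "exec cf s1 t2 s2" "t2 \<le> Tf (s1 m)" "s2 0 = f (s1 m)"
      "\<And>z. z < Suc m \<Longrightarrow> z \<noteq> 0 \<Longrightarrow> s2 z = s1 z" using cf[of s1] by auto
    have s1m: "s1 m = enc_graph n E" by (simp add: s1_def s0_def init_store_def)
    define s3 where "s3 = (\<lambda>z. if z < m then r z else s2 z)"
    have 3: "exec c s2 t s3" unfolding s3_def
      by (rule exec_frame[OF Xs(1)])
         (use 2 s1m fG in \<open>auto simp: m_def s1_def s0_def init_store_def\<close>)
    have s3: "s3 0 = enc_list (map (enc_set N) Xs)" "s3 m = enc_graph n E"
      using Xs(2) 2(4)[of m] s1m by (auto simp: s3_def m_def)
    define s4 where "s4 = s3(1 := eval_expr (NodeE (Var m) (Var 0)) s3)"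
    have s4: "s4 1 = Node (enc_graph n E) (enc_list (map (enc_set N) Xs))"
      by (simp add: s4_def s3)
    obtain t5 s5 where 5: "exec cg s4 t5 s5" "t5 \<le> Tg (s4 1)" "s5 0 = g (s4 1)"
      using cg[of s4] by auto
    have "exec prog s0 ((cost_expr (Var 0) + 1) + (t2 + (t + ((cost_expr (NodeE (Var m) (Var 0)) + 1) + t5)))) s5"
      (is "exec _ _ ?t _")
      unfolding prog_def
      using exec.Seq[OF exec.Assign exec.Seq[OF 2(1)[unfolded s1_def] exec.Seq[OF 3
        exec.Seq[OF exec.Assign 5(1)[unfolded s4_def]]]]] .
    moreover have "?t = 2 + t2 + t + 4 + t5" by simp
    ultimately have "exec prog s0 (2 + t2 + t + 4 + t5) s5" by metis
    then have out: "outputs_in prog (enc_graph n E) (map (enc_set n) Ys) (2 + t2 + t + 4 + t5)"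
      unfolding outputs_in_def using 5(3) s4 Ys(1)
      by (metis s0_def)
    have size': "size (enc_graph N E') \<le> F ?x"
      using ks[of "enc_graph n E"] fG by (simp add: F_def)
    have N: "N \<le> F ?x" using size' size_enc_graph_ge[of N E'] by linarith
    have card': "card {X. S {..<N} E' X} \<le> ?y + F ?x" using card N by linarith
    have len: "length Xs \<le> ?y + F ?x"
      using card' Xs(3,4) distinct_card by metis
    have t2: "t2 \<le> (?x + 2) ^ kf" using 2(2) kf[of "s1 m"] s1m by simp
    have "t \<le> (size (enc_graph N E') + card {X. S {..<N} E' X} + 2) ^ kc"
      using Xs(5) kc order_trans by blast
    also have "\<dots> \<le> (F ?x + (?y + F ?x) + 2) ^ kc"
      by (rule power_mono) (use size' card' in auto)
    finally have t: "t \<le> (F ?x + (?y + F ?x) + 2) ^ kc" .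
    have "size (enc_list (map (enc_set N) Xs)) \<le> length Xs * (2 * N + 1)"
      by (rule size_enc_sets_le)
    also have "\<dots> \<le> (?y + F ?x) * (2 * F ?x + 1)"
      by (rule mult_mono) (use len N in auto)
    finally have sz: "size (s4 1) \<le> ?x + (?y + F ?x) * (2 * F ?x + 1) + 1"
      unfolding s4 by simp
    have "t5 \<le> (size (s4 1) + 2) ^ kg" using 5(2) kg order_trans by blast
    also have "\<dots> \<le> (?x + (?y + F ?x) * (2 * F ?x + 1) + 1 + 2) ^ kg"
      by (rule power_mono) (use sz in auto)
    finally have t5: "t5 \<le> (?x + (?y + F ?x) * (2 * F ?x + 1) + 1 + 2) ^ kg" .
    have "2 + t2 + t + 4 + t5 \<le> T ?x ?y" using t2 t t5 unfolding T_def by linarith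
    also have "\<dots> \<le> bivariate_poly d' a' ?x ?y" using k d' order_trans by blast
    finally show ?thesis using out Ys by blast
  qed
  then show ?thesis unfolding output_polynomial_enumerable_def by blast
qed

section \<open>Alliances in graphs given by an adjacency predicate\<close>

definition degree_in :: "('a \<Rightarrow> 'a \<Rightarrow> bool) \<Rightarrow> 'a set \<Rightarrow> 'a \<Rightarrow> nat" where
  "degree_in adj B v = card {u \<in> B. adj u v}"

text \<open>The degree into the complement is eliminated in favour of the total degree, so vertices
  of equal total degree share one threshold for inner neighbours.\<close>

definition alliance :: "('a \<Rightarrow> 'a \<Rightarrow> bool) \<Rightarrow> 'a set \<Rightarrow> 'a set \<Rightarrow> bool" where
  "alliance adj V B \<longleftrightarrow> B \<subseteq> V \<and> (\<forall>v\<in>B. degree_in adj V v \<le> 2 * degree_in adj B v + 1)"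

definition minimal_alliance :: "('a \<Rightarrow> 'a \<Rightarrow> bool) \<Rightarrow> 'a set \<Rightarrow> 'a set \<Rightarrow> bool" where
  "minimal_alliance adj V B \<longleftrightarrow> B \<noteq> {} \<and> alliance adj V B \<and>
     (\<forall>C. C \<subset> B \<longrightarrow> C \<noteq> {} \<longrightarrow> \<not> alliance adj V C)"

lemma minimal_allianceD:
  assumes "minimal_alliance adj V B"
  shows "B \<noteq> {}" "alliance adj V B" "\<And>C. C \<subset> B \<Longrightarrow> C \<noteq> {} \<Longrightarrow> \<not> alliance adj V C"
  using assms unfolding minimal_alliance_def by simp_all

text \<open>Arguments about the reduction use structured vertices, while algorithms receive graphs
  on \<open>{..<N}\<close>. The position in \<open>vs\<close> serves as the number of a
  vertex.\<close>

locale listed_graph =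
  fixes adj :: "'a \<Rightarrow> 'a \<Rightarrow> bool" and vs :: "'a list"
  assumes adj_sym: "adj u v \<Longrightarrow> adj v u" and adj_irrefl: "\<not> adj u u"
    and distinct_vs: "distinct vs"
begin

definition edges :: "nat set set" where
  "edges = {{a, b} |a b. a < length vs \<and> b < length vs \<and> adj (vs ! a) (vs ! b)}"

definition indices :: "'a set \<Rightarrow> nat set" where
  "indices B = {a. a < length vs \<and> vs ! a \<in> B}"

lemma edges_iff: "{a, b} \<in> edges \<longleftrightarrow> a < length vs \<and> b < length vs \<and> adj (vs ! a) (vs ! b)"
  unfolding edges_def by (auto simp: doubleton_eq_iff intro: adj_sym)

lemma simple_graph_edges: "simple_graph {..<length vs} edges"
  unfolding simple_graph_def edges_def using adj_irrefl by fastforce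

lemma nth_image_indices: "B \<subseteq> set vs \<Longrightarrow> (!) vs ` indices B = B"
  unfolding indices_def by (auto simp: in_set_conv_nth image_iff) (metis in_mono in_set_conv_nth)

lemma indices_nth_image: "A \<subseteq> {..<length vs} \<Longrightarrow> indices ((!) vs ` A) = A"
  unfolding indices_def using distinct_vs by (auto simp: nth_eq_iff_index_eq subset_iff)

lemma indices_subset_iff:
  "B \<subseteq> set vs \<Longrightarrow> indices B \<subseteq> indices C \<longleftrightarrow> B \<subseteq> C"
  unfolding indices_def by (auto simp: in_set_conv_nth subset_iff)

lemma indices_eq_empty_iff: "B \<subseteq> set vs \<Longrightarrow> indices B = {} \<longleftrightarrow> B = {}"
  using indices_subset_iff[of B "{}"] by (auto simp: indices_def)

lemma deg_in_edges:
  assumes "B \<subseteq> set vs" "a < length vs"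
  shows "deg_in edges (indices B) a = degree_in adj B (vs ! a)"
  unfolding deg_in_def degree_in_def
proof (rule bij_betw_same_card)
  show "bij_betw ((!) vs) {u \<in> indices B. {u, a} \<in> edges} {u \<in> B. adj u (vs ! a)}"
    unfolding bij_betw_def
  proof
    show "inj_on ((!) vs) {u \<in> indices B. {u, a} \<in> edges}"
      using distinct_vs by (auto simp: inj_on_def indices_def nth_eq_iff_index_eq)
    show "(!) vs ` {u \<in> indices B. {u, a} \<in> edges} = {u \<in> B. adj u (vs ! a)}"
      using assms nth_image_indices[OF assms(1)]
      by (auto simp: edges_iff indices_def image_iff)
  qed
qed

lemma degree_in_Diff:
  assumes "B \<subseteq> set vs"
  shows "degree_in adj (set vs) v = degree_in adj B v + degree_in adj (set vs - B) v"
proof -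
  have "{u \<in> set vs. adj u v} = {u \<in> B. adj u v} \<union> {u \<in> set vs - B. adj u v}"
    using assms by auto
  then show ?thesis unfolding degree_in_def
    by (simp add: card_Un_disjoint disjoint_iff finite_subset[OF assms])
qed

lemma defensive_alliance_indices:
  assumes "B \<subseteq> set vs"
  shows "defensive_alliance {..<length vs} edges (indices B) \<longleftrightarrow> alliance adj (set vs) B"
proof -
  have compl: "{..<length vs} - indices B = indices (set vs - B)"
    by (auto simp: indices_def)
  have indices_less: "a \<in> indices B \<Longrightarrow> a < length vs" for a
    by (simp add: indices_def)
  have "(\<forall>a\<in>indices B. deg_in edges ({..<length vs} - indices B) a \<le> deg_in edges (indices B) a + 1)
    \<longleftrightarrow> (\<forall>a\<in>indices B. degree_in adj (set vs) (vs ! a) \<le> 2 * degree_in adj B (vs ! a) + 1)"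
    by (intro ball_cong refl)
      (simp add: compl indices_less deg_in_edges[OF assms] deg_in_edges[OF Diff_subset] degree_in_Diff[OF assms])
  also have "\<dots> \<longleftrightarrow>
      (\<forall>v\<in>(!) vs ` indices B. degree_in adj (set vs) v \<le> 2 * degree_in adj B v + 1)"
    by simp
  also have "\<dots> \<longleftrightarrow> (\<forall>v\<in>B. degree_in adj (set vs) v \<le> 2 * degree_in adj B v + 1)"
    unfolding nth_image_indices[OF assms] ..
  finally show ?thesis
    using assms unfolding defensive_alliance_def alliance_def by (auto simp: indices_def)
qed

text \<open>Between subsets of \<open>set vs\<close> and sets of positions, \<open>indices\<close>
  is a bijection preserving inclusion, emptiness and being an alliance, so minimality passes both
  ways.\<close>

lemma globally_minimal_iff:
  "globally_minimal_defensive_alliance {..<length vs} edges A \<longleftrightarrow>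
     (\<exists>B. minimal_alliance adj (set vs) B \<and> A = indices B)"
proof
  assume A: "globally_minimal_defensive_alliance {..<length vs} edges A"
  then have sub: "A \<subseteq> {..<length vs}"
    unfolding globally_minimal_defensive_alliance_def defensive_alliance_def by blast
  define B where "B = (!) vs ` A"
  have AB: "A = indices B" and B: "B \<subseteq> set vs"
    using indices_nth_image[OF sub] sub by (auto simp: B_def)
  have "minimal_alliance adj (set vs) B"
    unfolding minimal_alliance_def
  proof (intro conjI allI impI notI)
    show "B = {} \<Longrightarrow> False"
      using A AB indices_eq_empty_iff[OF B] unfolding globally_minimal_defensive_alliance_def by blast
    show "alliance adj (set vs) B"
      using A AB defensive_alliance_indices[OF B] unfolding globally_minimal_defensive_alliance_def by blast
    fix C assume C: "C \<subset> B" "C \<noteq> {}" "alliance adj (set vs) C"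
    then have Cs: "C \<subseteq> set vs" using B by blast
    have "indices C \<subset> A"
      using C(1) indices_subset_iff[OF B] indices_subset_iff[OF Cs] AB by blast
    then show False
      using A C Cs defensive_alliance_indices[OF Cs] indices_eq_empty_iff[OF Cs]
      unfolding globally_minimal_defensive_alliance_def by blast
  qed
  then show "\<exists>B. minimal_alliance adj (set vs) B \<and> A = indices B" using AB by blast
next
  assume "\<exists>B. minimal_alliance adj (set vs) B \<and> A = indices B"
  then obtain B where min: "minimal_alliance adj (set vs) B" and AB: "A = indices B" by blast
  then have B: "B \<subseteq> set vs" unfolding minimal_alliance_def alliance_def by blast
  show "globally_minimal_defensive_alliance {..<length vs} edges A"
    unfolding globally_minimal_defensive_alliance_def
  proof (intro conjI allI impI)
    show "A \<noteq> {}" using min AB indices_eq_empty_iff[OF B] unfolding minimal_alliance_def by blast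
    show "defensive_alliance {..<length vs} edges A"
      using min AB defensive_alliance_indices[OF B] unfolding minimal_alliance_def by blast
    fix A' assume A': "A' \<subset> A"
    define C where "C = (!) vs ` A'"
    have sub: "A' \<subseteq> {..<length vs}" using A' AB by (auto simp: indices_def)
    have A'C: "A' = indices C" and C: "C \<subseteq> set vs"
      using indices_nth_image[OF sub] sub by (auto simp: C_def)
    have "C \<subset> B"
      using A' AB A'C indices_subset_iff[OF B] indices_subset_iff[OF C] by blast
    then show "\<not> (A' \<noteq> {} \<and> defensive_alliance {..<length vs} edges A')"
      using min A'C defensive_alliance_indices[OF C] indices_eq_empty_iff[OF C]
      unfolding minimal_alliance_def by blast
  qed
qed

text \<open>\<open>I\<close> and its complement are taken in the whole vertex type;
  \<open>indices\<close> cuts both down to listed vertices.\<close>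

lemma split_graph_edges:
  assumes "\<And>u v. u \<in> I \<Longrightarrow> v \<in> I \<Longrightarrow> \<not> adj u v"
    and "\<And>u v. u \<notin> I \<Longrightarrow> v \<notin> I \<Longrightarrow> u \<noteq> v \<Longrightarrow> adj u v"
  shows "split_graph {..<length vs} edges"
  unfolding split_graph_def
proof (intro conjI exI)
  show "simple_graph {..<length vs} edges" by (rule simple_graph_edges)
  show "indices I \<union> indices (- I) = {..<length vs}" "indices I \<inter> indices (- I) = {}"
    by (auto simp: indices_def)
  show "independent_set edges (indices I)"
    using assms(1) by (auto simp: independent_set_def edges_iff indices_def)
  show "clique edges (indices (- I))"
    using assms(2) distinct_vs
    by (auto simp: clique_def edges_iff indices_def nth_eq_iff_index_eq)
qed

end


section \<open>The reduction graph\<close>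

datatype vertex = Col nat | Row nat | Pendant nat nat

text \<open>
  Row \<open>n\<close> ensures that every column \<open>u \<le> n\<close> meets at least two rows, so that it is not an
  alliance by itself; column \<open>n\<close> is the special one.
\<close>

definition hits :: "nat \<Rightarrow> nat set set \<Rightarrow> nat \<Rightarrow> nat \<Rightarrow> bool" where
  "hits n E i u \<longleftrightarrow>
     (if n \<le> i then if i = n then u \<le> n else u = n else u < n \<and> (u = i \<or> {i, u} \<in> E))"

text \<open>
  The pendant vertices complement the incidence matrix, so that all rows have the same degree.
\<close>

fun adjacent :: "nat \<Rightarrow> nat set set \<Rightarrow> vertex \<Rightarrow> vertex \<Rightarrow> bool" where
  "adjacent n E (Col u) (Row i) = hits n E i u"
| "adjacent n E (Row i) (Col u) = hits n E i u"
| "adjacent n E (Row i) (Row j) = (i \<noteq> j)"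
| "adjacent n E (Row i) (Pendant j u) = (i = j \<and> \<not> hits n E i u)"
| "adjacent n E (Pendant j u) (Row i) = (i = j \<and> \<not> hits n E i u)"
| "adjacent n E _ _ = False"

text \<open>Columns come first so that \<open>Col u\<close> receives number \<open>u\<close>, on
  which decoding relies. A pendant is listed for every pair, isolated where its row is hit by the
  column, so the list depends on \<open>m\<close> alone and not on the edges.\<close>

definition vertices :: "nat \<Rightarrow> vertex list" where
  "vertices m = map Col [0..<Suc m] @ map Row [0..<m] @
     concat (map (\<lambda>i. map (Pendant i) [0..<Suc m]) [0..<m])"

lemma set_vertices:
  "set (vertices m) = Col ` {..m} \<union> Row ` {..<m} \<union> {Pendant i u |i u. i < m \<and> u \<le> m}"
proof (rule set_eqI)
  fix v show "v \<in> set (vertices m) \<longleftrightarrow>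
    v \<in> Col ` {..m} \<union> Row ` {..<m} \<union> {Pendant i u |i u. i < m \<and> u \<le> m}"
    by (cases v) (auto simp: vertices_def image_iff simp del: upt_Suc)
qed

lemma distinct_vertices: "distinct (vertices m)"
proof -
  have "distinct (concat (map (\<lambda>i. map (Pendant i) [0..<Suc m]) [0..<k]))" for k
    by (induction k) (auto simp: distinct_map inj_on_def)
  then show ?thesis by (auto simp: vertices_def distinct_map inj_on_def)
qed

lemma vertices_nth: "u \<le> m \<Longrightarrow> vertices m ! u = Col u"
  by (simp add: vertices_def nth_append del: upt_Suc)

lemma length_vertices_gt: "m < length (vertices m)"
  by (simp add: vertices_def)

lemma adjacent_sym: "adjacent n E u v \<Longrightarrow> adjacent n E v u"
  by (induction n E u v rule: adjacent.induct) auto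

lemma adjacent_irrefl: "\<not> adjacent n E u u"
  by (cases u) auto

interpretation G: listed_graph "adjacent n E" "vertices m" for n E m
  by standard (auto intro: adjacent_sym simp: adjacent_irrefl distinct_vertices)

context
  fixes n :: nat and E :: "nat set set" and M :: nat
  assumes M_def: "M = n + n + 2"
begin

abbreviation "V \<equiv> set (vertices M)"
abbreviation "deg \<equiv> degree_in (adjacent n E)"

lemma n_less_M: "n < M"
  by (simp add: M_def)

text \<open>Those lying in \<open>V\<close> have degree at most one; what remains of
  \<open>V\<close> are the rows and the columns up to \<open>n\<close>.\<close>

definition trivial_vertices :: "vertex set" where
  "trivial_vertices = {Pendant i u |i u. True} \<union> Col ` {n<..}"

definition dom_alliance :: "nat set \<Rightarrow> vertex set" where
  "dom_alliance D = Row ` {..<M} \<union> Col ` insert n D"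

section \<open>Degrees and trivial alliances\<close>

lemma deg_Row:
  assumes "finite B"
  shows "deg B (Row i) = card {u. Col u \<in> B \<and> hits n E i u} + card {j. Row j \<in> B \<and> j \<noteq> i} +
    card {u. Pendant i u \<in> B \<and> \<not> hits n E i u}"
proof -
  have fin: "finite {u. Col u \<in> B \<and> hits n E i u}" "finite {j. Row j \<in> B \<and> j \<noteq> i}"
    "finite {u. Pendant i u \<in> B \<and> \<not> hits n E i u}"
    by (rule finite_subset[OF _ finite_vimageI[OF assms]], auto simp: inj_def)+
  have "{u \<in> B. adjacent n E u (Row i)} = Col ` {u. Col u \<in> B \<and> hits n E i u} \<union>
      Row ` {j. Row j \<in> B \<and> j \<noteq> i} \<union> Pendant i ` {u. Pendant i u \<in> B \<and> \<not> hits n E i u}"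
  proof (rule set_eqI)
    fix x show "x \<in> {u \<in> B. adjacent n E u (Row i)} \<longleftrightarrow> x \<in> Col ` {u. Col u \<in> B \<and> hits n E i u} \<union>
      Row ` {j. Row j \<in> B \<and> j \<noteq> i} \<union> Pendant i ` {u. Pendant i u \<in> B \<and> \<not> hits n E i u}"
      by (cases x) auto
  qed
  moreover have "card (Col ` {u. Col u \<in> B \<and> hits n E i u} \<union>
      Row ` {j. Row j \<in> B \<and> j \<noteq> i} \<union> Pendant i ` {u. Pendant i u \<in> B \<and> \<not> hits n E i u}) =
    card (Col ` {u. Col u \<in> B \<and> hits n E i u}) + card (Row ` {j. Row j \<in> B \<and> j \<noteq> i}) +
      card (Pendant i ` {u. Pendant i u \<in> B \<and> \<not> hits n E i u})"
    by (subst card_Un_disjoint, use fin in auto)+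
  ultimately show ?thesis
    unfolding degree_in_def by (simp add: card_image inj_on_def)
qed

text \<open>For each of the \<open>M + 1\<close> indices \<open>u\<close>, exactly one of
  \<open>Col u\<close> and \<open>Pendant i u\<close> is adjacent to the row; the clique adds
  \<open>M - 1\<close>.\<close>

lemma deg_V_Row:
  assumes "i < M"
  shows "deg V (Row i) = 2 * M"
proof -
  have "card {u. Col u \<in> V \<and> hits n E i u} + card {u. Pendant i u \<in> V \<and> \<not> hits n E i u} =
      card ({u. u \<le> M \<and> hits n E i u} \<union> {u. u \<le> M \<and> \<not> hits n E i u})"
    using assms by (subst card_Un_disjoint) (auto simp: set_vertices intro!: arg_cong2[where f = "(+)"] arg_cong[where f = card])
  also have "{u. u \<le> M \<and> hits n E i u} \<union> {u. u \<le> M \<and> \<not> hits n E i u} = {..M}" by auto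
  finally have "card {u. Col u \<in> V \<and> hits n E i u} + card {u. Pendant i u \<in> V \<and> \<not> hits n E i u} = M + 1"
    by simp
  moreover have "{j. Row j \<in> V \<and> j \<noteq> i} = {..<M} - {i}" by (auto simp: set_vertices)
  ultimately show ?thesis using assms by (simp add: deg_Row)
qed

text \<open>The \<open>+ 1\<close> in the alliance condition lets a vertex of degree at most one
  stand alone.\<close>

lemma trivial_alliance:
  assumes "p \<in> trivial_vertices \<inter> V"
  shows "alliance (adjacent n E) V {p}"
proof -
  have "\<exists>q. {u \<in> V. adjacent n E u p} \<subseteq> {q}"
  proof (cases p)
    case (Col u)
    then have "{w \<in> V. adjacent n E w p} = {}"
      using assms by (auto simp: trivial_vertices_def set_vertices hits_def split: if_splits)
    then show ?thesis by auto
  next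
    case (Pendant i u)
    then have "{w \<in> V. adjacent n E w p} \<subseteq> {Row i}"
      using assms by (auto simp: set_vertices)
    then show ?thesis by auto
  qed (use assms in \<open>auto simp: trivial_vertices_def\<close>)
  then obtain q where "{u \<in> V. adjacent n E u p} \<subseteq> {q}" ..
  from card_mono[OF _ this] have "deg V p \<le> 1" by (simp add: degree_in_def)
  then show ?thesis using assms by (simp add: alliance_def)
qed

lemma minimal_alliance_trivial:
  assumes "minimal_alliance (adjacent n E) V B" "p \<in> B" "p \<in> trivial_vertices"
  shows "B = {p}"
proof (rule ccontr)
  assume "B \<noteq> {p}"
  then have "{p} \<subset> B" using assms by blast
  moreover have "p \<in> V" using assms unfolding minimal_alliance_def alliance_def by blast
  ultimately show False
    using assms trivial_alliance[of p] unfolding minimal_alliance_def by blast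
qed

text \<open>A row has the \<open>M - 1\<close> other rows and one column: a dominating vertex for
  \<open>i < n\<close>, the special column otherwise. All neighbours of a column are rows, hence
  inside.\<close>

lemma alliance_dom_alliance:
  assumes "dominating_set {..<n} E D"
  shows "alliance (adjacent n E) V (dom_alliance D)"
  unfolding alliance_def
proof (intro conjI ballI)
  have D: "D \<subseteq> {..<n}" using assms unfolding dominating_set_def by blast
  show sub: "dom_alliance D \<subseteq> V"
    using D n_less_M by (auto simp: dom_alliance_def set_vertices)
  have fin: "finite (dom_alliance D)" using sub finite_subset by blast
  fix v assume "v \<in> dom_alliance D"
  then consider i where "v = Row i" "i < M" | u where "v = Col u" by (auto simp: dom_alliance_def)
  then show "deg V v \<le> 2 * deg (dom_alliance D) v + 1"
  proof cases
    case 1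
    have "\<exists>u. Col u \<in> dom_alliance D \<and> hits n E i u"
    proof (cases "i < n")
      case True
      then have "i \<in> D \<or> (\<exists>u\<in>D. {u, i} \<in> E)" using assms unfolding dominating_set_def by blast
      then show ?thesis using True D
        by (auto simp: dom_alliance_def hits_def insert_commute)
    qed (auto simp: dom_alliance_def hits_def)
    then have "{u. Col u \<in> dom_alliance D \<and> hits n E i u} \<noteq> {}" by blast
    moreover have "finite {u. Col u \<in> dom_alliance D \<and> hits n E i u}"
      by (rule finite_subset[of _ "{..n}"]) (use D in \<open>auto simp: dom_alliance_def\<close>)
    ultimately have "1 \<le> card {u. Col u \<in> dom_alliance D \<and> hits n E i u}"
      by (simp add: Suc_le_eq card_gt_0_iff)
    moreover have "{j. Row j \<in> dom_alliance D \<and> j \<noteq> i} = {..<M} - {i}"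
      by (auto simp: dom_alliance_def)
    ultimately have "M \<le> deg (dom_alliance D) (Row i)"
      using 1 by (simp add: deg_Row[OF fin])
    then show ?thesis using 1 deg_V_Row by simp
  next
    case 2
    have "{w \<in> V. adjacent n E w v} \<subseteq> {w \<in> dom_alliance D. adjacent n E w v}"
      using 2 by (auto simp: set_vertices dom_alliance_def)
    then have "deg V v \<le> deg (dom_alliance D) v"
      unfolding degree_in_def using fin by (intro card_mono) auto
    then show ?thesis by simp
  qed
qed

text \<open>Stated for arbitrary alliances because it is also applied to subsets of a
  \<open>dom_alliance\<close> when its minimality is shown.\<close>

lemma nontrivial_alliance:
  assumes B: "alliance (adjacent n E) V B" "B \<noteq> {}" "B \<inter> trivial_vertices = {}"
  shows "\<exists>D. dominating_set {..<n} E D \<and> B = dom_alliance D"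
proof -
  have sub: "B \<subseteq> V" and deg: "\<And>v. v \<in> B \<Longrightarrow> deg V v \<le> 2 * deg B v + 1"
    using B(1) unfolding alliance_def by auto
  have fin: "finite B" using sub finite_subset by blast
  have noPendant: "Pendant i u \<notin> B" for i u
  proof -
    have "Pendant i u \<in> trivial_vertices" by (auto simp: trivial_vertices_def)
    then show ?thesis using B(3) by blast
  qed
  have Col_le: "u \<le> n" if "Col u \<in> B" for u 
  proof (rule ccontr)
    assume "\<not> u \<le> n"
    then have "Col u \<in> trivial_vertices" by (auto simp: trivial_vertices_def)
    then show False using that B(3) by blast
  qed
  have Row_lt: "i < M" if "Row i \<in> B" for i using sub that by (auto simp: set_vertices)
  have B_sub: "B \<subseteq> Row ` {..<M} \<union> Col ` {..n}"
  proof
    fix v assume "v \<in> B"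
    then show "v \<in> Row ` {..<M} \<union> Col ` {..n}"
      using noPendant Col_le Row_lt by (cases v) auto
  qed
  \<comment> \<open>By parity, \<open>2 * M \<le> 2 * d + 1\<close> means
    \<open>M \<le> d\<close>.\<close>
  have degRow: "M \<le> card {u. Col u \<in> B \<and> hits n E i u} + card {j. Row j \<in> B \<and> j \<noteq> i}"
    if "Row i \<in> B" for i
    using deg[OF that] deg_V_Row[OF Row_lt[OF that]] deg_Row[OF fin, of i] noPendant by simp
  have "\<exists>i. Row i \<in> B"
  proof (rule ccontr)
    assume no: "\<nexists>i. Row i \<in> B"
    obtain v where "v \<in> B" using B(2) by blast
    then obtain u where u: "Col u \<in> B" using no noPendant by (cases v) auto
    \<comment> \<open>A second neighbour besides \<open>Row n\<close>: a vertex dominates itself, so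
      \<open>Row u\<close> serves for \<open>u < n\<close>, and row \<open>Suc n\<close> for the
      special column. Degree 2 with no inner neighbour violates the condition.\<close>
    define i where "i = (if u = n then Suc n else u)"
    have i: "i < M" "i \<noteq> n" "hits n E i u"
      using Col_le[OF u] by (auto simp: i_def hits_def M_def)
    have "{Row i, Row n} \<subseteq> {w \<in> V. adjacent n E w (Col u)}"
      using i Col_le[OF u] by (auto simp: set_vertices M_def hits_def)
    then have "card {Row i, Row n} \<le> deg V (Col u)"
      unfolding degree_in_def by (intro card_mono) auto
    moreover have "{w \<in> B. adjacent n E w (Col u)} = {}"
    proof -
      have "\<not> adjacent n E w (Col u)" if "w \<in> B" for w
        using that no by (cases w) auto
      then show ?thesis by blast
    qed
    then have "deg B (Col u) = 0" by (simp only: degree_in_def card.empty)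
    ultimately show False using deg[OF u] i by simp
  qed
  have "\<exists>i>n. Row i \<in> B"
  proof (rule ccontr)
    assume no: "\<not> (\<exists>i>n. Row i \<in> B)"
    obtain i where i: "Row i \<in> B" using \<open>\<exists>i. Row i \<in> B\<close> ..
    then have "i \<le> n" using no not_le by blast
    \<comment> \<open>At most \<open>n + 1\<close> columns and \<open>n\<close> other rows are left,
      one short of \<open>M\<close>.\<close>
    have "card {u. Col u \<in> B \<and> hits n E i u} \<le> card {..n}"
      using Col_le by (intro card_mono) auto
    moreover have "card {j. Row j \<in> B \<and> j \<noteq> i} \<le> card ({..n} - {i})"
      using no not_le by (intro card_mono) auto
    ultimately show False using degRow[OF i] \<open>i \<le> n\<close> by (simp add: M_def)
  qed
  then obtain i where i: "n < i" "Row i \<in> B" by blast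
  have rows_le: "card {j. Row j \<in> B \<and> j \<noteq> k} \<le> M - 1" if "k < M" for k
  proof -
    have "card {j. Row j \<in> B \<and> j \<noteq> k} \<le> card ({..<M} - {k})"
      using Row_lt by (intro card_mono) auto
    then show ?thesis using that by simp
  qed
  have "{u. Col u \<in> B \<and> hits n E k u} \<noteq> {}" if "Row k \<in> B" for k
  proof
    assume "{u. Col u \<in> B \<and> hits n E k u} = {}"
    then have "card {u. Col u \<in> B \<and> hits n E k u} = 0" by (simp only: card.empty)
    then show False using degRow[OF that] rows_le[OF Row_lt[OF that]] Row_lt[OF that] by simp
  qed
  then have hit: "\<exists>u. Col u \<in> B \<and> hits n E k u" if "Row k \<in> B" for k using that by blast
  have special: "Col n \<in> B" using hit[OF i(2)] i(1) by (auto simp: hits_def split: if_splits)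
  \<comment> \<open>Row \<open>i > n\<close> sees only column \<open>n\<close>. If some row were
    missing, it would have at most \<open>(M - 2) + 1\<close> inner neighbours.\<close>
  have rows: "Row j \<in> B" if "j < M" for j
  proof (rule ccontr)
    assume "Row j \<notin> B"
    then have "card {j. Row j \<in> B \<and> j \<noteq> i} \<le> card ({..<M} - {i} - {j})"
      using Row_lt by (intro card_mono) auto
    moreover have "card ({..<M} - {i} - {j}) = M - 2"
      using that Row_lt[OF i(2)] \<open>Row j \<notin> B\<close> i(2) by (subst card_Diff_singleton) auto
    moreover have "card {u. Col u \<in> B \<and> hits n E i u} \<le> card {n}"
      using i(1) by (intro card_mono) (auto simp: hits_def)
    ultimately show False using degRow[OF i(2)] by (simp add: M_def)
  qed
  define D where "D = {u. u < n \<and> Col u \<in> B}"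
  have "dominating_set {..<n} E D"
    unfolding dominating_set_def
  proof (intro conjI ballI)
    show "D \<subseteq> {..<n}" by (auto simp: D_def)
    fix v assume v: "v \<in> {..<n}"
    then have "Row v \<in> B" by (intro rows) (auto simp: M_def)
    then obtain u where "Col u \<in> B" "hits n E v u" using hit by blast
    then have "u \<in> D" "u = v \<or> {u, v} \<in> E"
      using v by (auto simp: D_def hits_def insert_commute)
    then show "v \<in> D \<or> (\<exists>u\<in>D. {u, v} \<in> E)" by blast
  qed
  moreover have "B = dom_alliance D"
  proof
    show "B \<subseteq> dom_alliance D"
    proof
      fix v assume v: "v \<in> B"
      then consider i where "v = Row i" "i < M" | u where "v = Col u" "u \<le> n" using B_sub by blast
      then show "v \<in> dom_alliance D"
        using v by cases (auto simp: dom_alliance_def D_def le_less)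
    qed
    show "dom_alliance D \<subseteq> B"
      using rows special by (auto simp: dom_alliance_def D_def)
  qed
  ultimately show ?thesis by blast
qed

section \<open>Minimal alliances and minimal dominating sets\<close>

lemma Col_in_dom_alliance_iff: "Col u \<in> dom_alliance D \<longleftrightarrow> u = n \<or> u \<in> D"
  by (auto simp: dom_alliance_def)

text \<open>As \<open>D\<close> avoids \<open>n\<close>, the special column present on both sides
  cannot stand in for an element of \<open>D\<close>.\<close>

lemma dom_alliance_subset_iff:
  assumes "D \<subseteq> {..<n}"
  shows "dom_alliance D \<subseteq> dom_alliance D' \<longleftrightarrow> D \<subseteq> D'"
proof
  assume sub: "dom_alliance D \<subseteq> dom_alliance D'"
  show "D \<subseteq> D'"
  proof
    fix u assume u: "u \<in> D"
    then have "Col u \<in> dom_alliance D'" using sub Col_in_dom_alliance_iff by blast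
    moreover have "u \<noteq> n" using u assms by blast
    ultimately show "u \<in> D'" using Col_in_dom_alliance_iff by blast
  qed
qed (unfold dom_alliance_def, blast)

lemma dom_alliance_nontrivial:
  assumes "D \<subseteq> {..<n}"
  shows "dom_alliance D \<inter> trivial_vertices = {}"
proof (rule ccontr)
  assume "dom_alliance D \<inter> trivial_vertices \<noteq> {}"
  then obtain v where "v \<in> dom_alliance D" "v \<in> trivial_vertices" by blast
  then show False
    using assms by (cases v) (auto simp: dom_alliance_def trivial_vertices_def)
qed

lemma special_nontrivial: "Col n \<notin> trivial_vertices"
  by (auto simp: trivial_vertices_def)

text \<open>\<open>dom_alliance\<close> embeds dominating sets, ordered by inclusion, into
  alliances, and every non-empty alliance without trivial vertices is in its image. Subsets of such
  an alliance stay free of trivial vertices, so minimality on one side is minimality on the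
  other.\<close>

lemma minimal_alliance_special_iff:
  "minimal_alliance (adjacent n E) V B \<and> Col n \<in> B \<longleftrightarrow>
     (\<exists>D. minimal_dominating_set {..<n} E D \<and> B = dom_alliance D)"
proof
  assume "minimal_alliance (adjacent n E) V B \<and> Col n \<in> B"
  then have min: "minimal_alliance (adjacent n E) V B" and special: "Col n \<in> B" by auto
  have "p \<notin> trivial_vertices" if "p \<in> B" for p
  proof
    assume "p \<in> trivial_vertices"
    then have "B = {p}" by (rule minimal_alliance_trivial[OF min that])
    then show False using special special_nontrivial \<open>p \<in> trivial_vertices\<close> by simp
  qed
  then have "B \<inter> trivial_vertices = {}" by blast
  then obtain D where D: "dominating_set {..<n} E D" "B = dom_alliance D"
    using nontrivial_alliance[OF minimal_allianceD(2,1)[OF min]] by auto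
  have "\<not> dominating_set {..<n} E D'" if "D' \<subset> D" for D'
  proof
    assume D': "dominating_set {..<n} E D'"
    have "D \<subseteq> {..<n}" "D' \<subseteq> {..<n}"
      using D(1) D' by (simp_all only: dominating_set_def)
    then have "dom_alliance D' \<subset> B"
      using that by (simp only: D(2) less_le_not_le dom_alliance_subset_iff simp_thms)
    moreover have "dom_alliance D' \<noteq> {}" unfolding dom_alliance_def by blast
    ultimately show False
      using minimal_allianceD(3)[OF min] alliance_dom_alliance[OF D'] by blast
  qed
  then show "\<exists>D. minimal_dominating_set {..<n} E D \<and> B = dom_alliance D"
    using D unfolding minimal_dominating_set_def by (intro exI[of _ D]) auto
next
  assume "\<exists>D. minimal_dominating_set {..<n} E D \<and> B = dom_alliance D"
  then obtain D where D: "minimal_dominating_set {..<n} E D" and B: "B = dom_alliance D" by auto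
  have dom: "dominating_set {..<n} E D" using D unfolding minimal_dominating_set_def by simp
  then have Dn: "D \<subseteq> {..<n}" unfolding dominating_set_def by simp
  have special: "Col n \<in> B" unfolding B dom_alliance_def by simp
  have "\<not> alliance (adjacent n E) V C" if C: "C \<subset> B" "C \<noteq> {}" for C
  proof
    assume al: "alliance (adjacent n E) V C"
    have "C \<inter> trivial_vertices = {}" using C(1) dom_alliance_nontrivial[OF Dn] B by blast
    then obtain D' where D': "dominating_set {..<n} E D'" "C = dom_alliance D'"
      using nontrivial_alliance[OF al C(2)] by auto
    then have "D' \<subseteq> {..<n}" unfolding dominating_set_def by simp
    then have "D' \<subset> D"
      using C(1) Dn by (simp only: B D'(2) less_le_not_le dom_alliance_subset_iff simp_thms)
    then show False using D D'(1) unfolding minimal_dominating_set_def by simp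
  qed
  then show "minimal_alliance (adjacent n E) V B \<and> Col n \<in> B"
    using alliance_dom_alliance[OF dom] special unfolding minimal_alliance_def B by auto
qed

text \<open>Every \<open>dom_alliance\<close> contains the special column, so an alliance without it
  must meet the trivial vertices. This bounds the surplus solutions by the number of
  vertices.\<close>

lemma minimal_alliance_not_special:
  assumes "minimal_alliance (adjacent n E) V B" "Col n \<notin> B"
  shows "\<exists>p\<in>V. B = {p}"
proof (cases "B \<inter> trivial_vertices = {}")
  case True
  then obtain D where "B = dom_alliance D"
    using nontrivial_alliance[OF minimal_allianceD(2,1)[OF assms(1)]] by auto
  then show ?thesis using assms(2) by (simp add: dom_alliance_def)
next
  case False
  then obtain p where p: "p \<in> B" "p \<in> trivial_vertices" by auto
  then have "B = {p}" by (rule minimal_alliance_trivial[OF assms(1)])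
  moreover have "B \<subseteq> V" using minimal_allianceD(2)[OF assms(1)] by (simp add: alliance_def)
  ultimately show ?thesis using p(1) by auto
qed

section \<open>Numbered solutions of the reduced graph\<close>

abbreviation "reduced_edges \<equiv> G.edges n E M"
abbreviation "reduced_order \<equiv> length (vertices M)"

abbreviation solutions :: "nat set set" where
  "solutions \<equiv> {A. globally_minimal_defensive_alliance {..<reduced_order} reduced_edges A}"

lemma mem_indices_iff: "u \<le> M \<Longrightarrow> u \<in> G.indices M B \<longleftrightarrow> Col u \<in> B"
  using length_vertices_gt[of M] by (auto simp: G.indices_def vertices_nth)

lemma special_solutions:
  "{A \<in> solutions. n \<in> A} = (\<lambda>D. G.indices M (dom_alliance D)) ` {D. minimal_dominating_set {..<n} E D}"
proof -
  have "{A \<in> solutions. n \<in> A} =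
      G.indices M ` {B. minimal_alliance (adjacent n E) V B \<and> Col n \<in> B}"
    using mem_indices_iff[of n] n_less_M by (auto simp: G.globally_minimal_iff)
  also have "{B. minimal_alliance (adjacent n E) V B \<and> Col n \<in> B} =
      dom_alliance ` {D. minimal_dominating_set {..<n} E D}"
    unfolding minimal_alliance_special_iff by (simp only: image_def mem_Collect_eq bex_simps)
  finally show ?thesis by (simp only: image_image)
qed

text \<open>Truncation to the first \<open>n\<close> numbers is thus a left inverse of the passage
  to solutions. It serves both for decoding and for the absence of repetitions.\<close>

lemma indices_dom_alliance_Int:
  assumes "minimal_dominating_set {..<n} E D"
  shows "G.indices M (dom_alliance D) \<inter> {..<n} = D"
proof -
  have D: "D \<subseteq> {..<n}"
    using assms by (simp add: minimal_dominating_set_def dominating_set_def)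
  have "u \<in> G.indices M (dom_alliance D) \<longleftrightarrow> u \<in> D" if "u < n" for u
    using that n_less_M by (simp add: mem_indices_iff Col_in_dom_alliance_iff)
  then show ?thesis using D by auto
qed

lemma card_solutions: "card solutions \<le> card {D. minimal_dominating_set {..<n} E D} + reduced_order"
proof -
  have fin: "finite {D. minimal_dominating_set {..<n} E D}"
  proof (rule finite_subset)
    show "{D. minimal_dominating_set {..<n} E D} \<subseteq> Pow {..<n}"
      by (simp only: minimal_dominating_set_def dominating_set_def) blast
  qed simp
  have "{A \<in> solutions. n \<notin> A} \<subseteq> (\<lambda>p. G.indices M {p}) ` V"
  proof
    fix A assume "A \<in> {A \<in> solutions. n \<notin> A}"
    then obtain B where B: "minimal_alliance (adjacent n E) V B" "A = G.indices M B" "n \<notin> A"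
      by (auto simp: G.globally_minimal_iff)
    then have "Col n \<notin> B" using mem_indices_iff[of n B] n_less_M by simp
    from minimal_alliance_not_special[OF B(1) this] B(2)
    show "A \<in> (\<lambda>p. G.indices M {p}) ` V" by auto
  qed
  then have "card {A \<in> solutions. n \<notin> A} \<le> card V"
    by (rule surj_card_le[rotated]) (rule finite_set)
  also have "\<dots> \<le> reduced_order" by (rule card_length)
  finally have "card {A \<in> solutions. n \<notin> A} \<le> reduced_order" .
  moreover have "card {A \<in> solutions. n \<in> A} \<le> card {D. minimal_dominating_set {..<n} E D}"
    unfolding special_solutions by (rule card_image_le[OF fin])
  moreover have "{A \<in> S. n \<in> A} \<union> {A \<in> S. n \<notin> A} = S" for S by auto
  then have "card solutions \<le> card {A \<in> solutions. n \<in> A} + card {A \<in> solutions. n \<notin> A}"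
    using card_Un_le[of "{A \<in> solutions. n \<in> A}" "{A \<in> solutions. n \<notin> A}"] by (simp only:)
  ultimately show ?thesis by linarith
qed

lemma decode_solutions:
  assumes "distinct As" "set As = solutions"
  defines "Ds \<equiv> map (\<lambda>A. A \<inter> {..<n}) (filter (\<lambda>A. n \<in> A) As)"
  shows "distinct Ds" "set Ds = {D. minimal_dominating_set {..<n} E D}"
proof -
  have eq: "set (filter (\<lambda>A. n \<in> A) As) =
      (\<lambda>D. G.indices M (dom_alliance D)) ` {D. minimal_dominating_set {..<n} E D}"
    using special_solutions assms(2) by (simp add: set_filter)
  have "inj_on (\<lambda>A. A \<inter> {..<n}) (set (filter (\<lambda>A. n \<in> A) As))"
    unfolding eq by (auto simp: inj_on_def indices_dom_alliance_Int)
  then show "distinct Ds" using assms(1) by (simp add: Ds_def distinct_map del: set_filter)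
  show "set Ds = {D. minimal_dominating_set {..<n} E D}"
    unfolding Ds_def set_map eq image_image
    using indices_dom_alliance_Int by (auto simp: image_iff)
qed

lemma split_graph_reduction: "split_graph {..<reduced_order} reduced_edges"
proof (rule G.split_graph_edges)
  fix u v assume "u \<in> - range Row" "v \<in> - range Row"
  then show "\<not> adjacent n E u v" by (cases u; cases v) auto
qed auto

end


section \<open>Computing the reduction\<close>

lemma Node_Leaf_unary: "Node Leaf (unary k) = unary (Suc k)"
  by (simp add: unary_def)

text \<open>The counterpart of \<open>hits\<close> on codes, with \<open>n\<close> recovered as the
  number of rows of the adjacency matrix.\<close>

definition thits :: "tree \<Rightarrow> tree \<Rightarrow> tree \<Rightarrow> bool" where
  "thits G i u \<longleftrightarrow>
     (if tle (tlength G) i then if teq i (tlength G) then tle u (tlength G) else teq u (tlength G)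
      else \<not> tle (tlength G) u \<and> (teq u i \<or> \<not> tnth (tnth G i) u = Leaf))"

lemma tlength_enc_graph: "tlength (enc_graph n E) = unary n"
  by (simp add: enc_graph_def)

lemma tnth_enc_set: "u < n \<Longrightarrow> tnth (enc_set n X) (unary u) = enc_bool (u \<in> X)"
  by (simp add: enc_set_def)

lemma tnth_enc_graph: "i < n \<Longrightarrow> tnth (enc_graph n E) (unary i) = enc_set n {j. {i, j} \<in> E}"
  by (simp add: enc_graph_def)

lemma thits_correct: "thits (enc_graph n E) (unary i) (unary u) \<longleftrightarrow> hits n E i u"
  by (auto simp: thits_def hits_def tlength_enc_graph tnth_enc_graph tnth_enc_set)

lemma pdec_thits:
  "ptime f \<Longrightarrow> ptime g \<Longrightarrow> ptime h \<Longrightarrow> pdec (\<lambda>x. thits (f x) (g x) (h x))"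
  unfolding thits_def by (intro ptime_intros ptime_list_intros)

text \<open>The three tags are chosen to be told apart by testing first the tag and then its right
  subtree for \<open>Leaf\<close>.\<close>

fun enc_vertex :: "vertex \<Rightarrow> tree" where
  "enc_vertex (Col u) = Node Leaf (unary u)"
| "enc_vertex (Row i) = Node (Node Leaf Leaf) (unary i)"
| "enc_vertex (Pendant i u) = Node (Node Leaf (Node Leaf Leaf)) (Node (unary i) (unary u))"

definition tadjacent :: "tree \<Rightarrow> tree \<Rightarrow> tree \<Rightarrow> bool" where
  "tadjacent G p q \<longleftrightarrow>
     (if left p = Leaf then
        \<not> left q = Leaf \<and> right (left q) = Leaf \<and> thits G (right q) (right p)
      else if right (left p) = Leaf then
        (if left q = Leaf then thits G (right p) (right q)
         else if right (left q) = Leaf then \<not> teq (right p) (right q)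
         else teq (right p) (left (right q)) \<and> \<not> thits G (right p) (right (right q)))
      else \<not> left q = Leaf \<and> right (left q) = Leaf \<and>
        teq (right q) (left (right p)) \<and> \<not> thits G (right q) (right (right p)))"

lemma tadjacent_correct:
  "tadjacent (enc_graph n E) (enc_vertex p) (enc_vertex q) \<longleftrightarrow> adjacent n E p q"
  by (cases p; cases q) (auto simp: tadjacent_def thits_correct)

lemma pdec_tadjacent:
  "ptime f \<Longrightarrow> ptime g \<Longrightarrow> ptime h \<Longrightarrow> pdec (\<lambda>x. tadjacent (f x) (g x) (h x))"
  unfolding tadjacent_def by (intro ptime_intros ptime_list_intros pdec_thits)

definition trows :: "tree \<Rightarrow> tree" where
  "trows G = Node Leaf (Node Leaf (tappend (tlength G) (tlength G)))"

lemma trows_enc_graph: "trows (enc_graph n E) = unary (n + n + 2)"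
  by (simp add: trows_def tlength_enc_graph unary_def flip: replicate_add)

definition tvertices :: "tree \<Rightarrow> tree" where
  "tvertices m =
     tappend (tmap (\<lambda>u. Node Leaf u) (trange (Node Leaf m)))
       (tappend (tmap (\<lambda>i. Node (Node Leaf Leaf) i) (trange m))
         (tconcat (tmap (\<lambda>i. tmap (\<lambda>u. Node (Node Leaf (Node Leaf Leaf)) (Node i u))
           (trange (Node Leaf m))) (trange m))))"

lemma tvertices_unary: "tvertices (unary m) = enc_list (map enc_vertex (vertices m))"
proof -
  have tconcat_map: "tconcat (enc_list (map (\<lambda>i. enc_list (f i)) xs)) = enc_list (concat (map f xs))"
    for f and xs :: "nat list"
    using tconcat_enc_list[of "map f xs"] by (simp add: comp_def)
  show ?thesis
    by (simp add: tvertices_def vertices_def Node_Leaf_unary[of m] map_concat comp_def tconcat_map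
        del: upt_Suc)
qed

lemma ptime_tvertices: "ptime f \<Longrightarrow> ptime (\<lambda>x. tvertices (trows (f x)))"
  by (rule ptime_comp[where f = "\<lambda>G. tvertices (trows G)"])
    (unfold tvertices_def trows_def, intro ptime_intros ptime_list_intros)

definition treduce :: "tree \<Rightarrow> tree" where
  "treduce G = tmap (\<lambda>p. tmap (\<lambda>q. enc_bool (tadjacent G p q)) (tvertices (trows G)))
     (tvertices (trows G))"

lemma ptime_treduce: "ptime treduce"
proof -
  have "ptime (\<lambda>G. treduce G)"
    unfolding treduce_def
    by (intro ptime_list_intros ptime_intros ptime_tvertices pdec_tadjacent)
  then show ?thesis by simp
qed

lemma map_eq_map_nth: "map f xs = map (\<lambda>i. f (xs ! i)) [0..<length xs]"
  by (rule nth_equalityI) auto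

lemma treduce_enc_graph:
  "treduce (enc_graph n E) =
     enc_graph (length (vertices (n + n + 2))) (G.edges n E (n + n + 2))"
proof -
  let ?vs = "vertices (n + n + 2)"
  have "treduce (enc_graph n E) =
      enc_list (map (\<lambda>p. enc_list (map (\<lambda>q. enc_bool (adjacent n E p q)) ?vs)) ?vs)"
    by (simp add: treduce_def trows_enc_graph tvertices_unary comp_def tadjacent_correct)
  also have "\<dots> = enc_list (map (\<lambda>a. enc_list (map (\<lambda>b. enc_bool (adjacent n E (?vs ! a) (?vs ! b)))
      [0..<length ?vs])) [0..<length ?vs])"
    by (subst (1 2) map_eq_map_nth) (rule refl)
  also have "\<dots> = enc_graph (length ?vs) (G.edges n E (n + n + 2))"
    unfolding enc_graph_def enc_set_def
    by (intro arg_cong[where f = enc_list] map_cong refl) (auto simp: G.edges_iff)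
  finally show ?thesis .
qed

text \<open>Entry \<open>n\<close> of a vector belongs to the special column and the entries below
  \<open>n\<close> to the dominating set. The left component of the pair supplies only
  \<open>n\<close>.\<close>

definition tdecode :: "tree \<Rightarrow> tree" where
  "tdecode z = tmap (\<lambda>A. tmap (\<lambda>u. tnth A u) (trange (tlength (left z))))
     (tfilter (\<lambda>A. \<not> tnth A (tlength (left z)) = Leaf) (right z))"

lemma ptime_tdecode: "ptime tdecode"
proof -
  have "ptime (\<lambda>z. tdecode z)"
    unfolding tdecode_def by (intro ptime_list_intros ptime_intros)
  then show ?thesis by simp
qed

lemma tdecode_correct:
  assumes "n < N"
  shows "tdecode (Node (enc_graph n E) (enc_list (map (enc_set N) As))) =
    enc_list (map (enc_set n) (map (\<lambda>A. A \<inter> {..<n}) (filter (\<lambda>A. n \<in> A) As)))"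
proof -
  have "filter (\<lambda>A. \<not> tnth A (unary n) = Leaf) (map (enc_set N) As) =
      map (enc_set N) (filter (\<lambda>A. n \<in> A) As)"
    using assms by (simp add: filter_map comp_def tnth_enc_set)
  moreover have "enc_list (map (\<lambda>u. tnth (enc_set N A) (unary u)) [0..<n]) = enc_set n (A \<inter> {..<n})" for A
    using assms by (subst enc_set_def[of n]) (auto simp: tnth_enc_set intro!: arg_cong[where f = enc_list])
  ultimately show ?thesis
    by (simp add: tdecode_def tlength_enc_graph comp_def)
qed

theorem theorem6:
  assumes "output_polynomial_enumerable split_graph globally_minimal_defensive_alliance"
  shows "output_polynomial_enumerable simple_graph minimal_dominating_set"
proof (rule output_polynomial_enumerable_reduction[OF assms ptime_treduce ptime_tdecode])
  fix n :: nat and E :: "nat set set"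
  let ?m = "n + n + 2"
  let ?N = "length (vertices ?m)"
  \<comment> \<open>This ensures that the entry of the special column exists in every characteristic
    vector of the reduced graph.\<close>
  have "n < ?N" using length_vertices_gt[of ?m] by simp
  then show "\<exists>N E'. split_graph {..<N} E' \<and> treduce (enc_graph n E) = enc_graph N E' \<and>
      card {X. globally_minimal_defensive_alliance {..<N} E' X} \<le>
        card {X. minimal_dominating_set {..<n} E X} + N \<and>
      (\<forall>Xs. distinct Xs \<longrightarrow> set Xs = {X. globally_minimal_defensive_alliance {..<N} E' X} \<longrightarrow>
        (\<exists>Ys. tdecode (Node (enc_graph n E) (enc_list (map (enc_set N) Xs))) = enc_list (map (enc_set n) Ys) \<and>
          distinct Ys \<and> set Ys = {X. minimal_dominating_set {..<n} E X}))"
    by (intro exI[of _ ?N] exI[of _ "G.edges n E ?m"] conjI allI impI split_graph_reduction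
        treduce_enc_graph card_solutions refl)
      (use tdecode_correct decode_solutions[OF refl] in blast)
qed

end
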